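(* Let $(Y,*,\circ)$ be a left skew brace, $(A,+)$ an abelian group (viewed as the left skew brace $(A,+,+)$), and let $(\phi_*,\phi_\circ,\xi)$ be the direction of some exact sequence of left skew braces with kernel $(A,+,+)$ and quotient $(Y,*,\circ)$. (a) Let $1\to(A,+,+)\xrightarrow{k_f}(X,*,\circ)\xrightarrow{f}(Y,*,\circ)\to1$ and $1\to(A,+,+)\xrightarrow{k_{f'}}(X',*,\circ)\xrightarrow{f'}(Y,*,\circ)\to1$ be two exact sequences of left skew braces with direction $(\phi_*,\phi_\circ,\xi)$. Let $X\otimes_Y X'$ be the quotient of the left skew brace $X\times_YX'=\{(x,x')\mid f(x)=f'(x')\}$ by the ideal $\{(k_f(-a),k_{f'}(a))\mid a\in A\}$, with quotient map $\theta\colon X\times_Y X'\to X\otimes_Y X'$, let $k_{f\otimes_Yf'}\colon A\to X\otimes_YX'$ be $a\mapsto\theta(1,k_{f'}(a))$, and let $f\otimes_Yf'\colon X\otimes_YX'\to Y$ be induced by $(x,x')\mapsto f(x)$. Then $$1\to(A,+,+)\xrightarrow{k_{f\otimes_Yf'}}X\otimes_YX'\xrightarrow{f\otimes_Yf'}(Y,*,\circ)\to1$$ is an exact sequence of left skew braces with direction $(\phi_*,\phi_\circ,\xi)$ (the Baer sum of the two sequences). (b) The Baer sum makes the set of isomorphism classes of exact sequences of left skew braces with kernel $(A,+,+)$, quotient $(Y,*,\circ)$ and direction $(\phi_*,\phi_\circ,\xi)$ an abelian group. The inverse of the class of $(k,f)$ is the class of the sequence $(-k,f)$, where $(-k)(a)=k(-a)$.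 The unit is the class of the split sequence $A\to Y\times A\to Y$ with maps $a\mapsto(1,a)$ and $(y,a)\mapsto y$, where $Y\times A$ carries the two laws $$(y,a)\ltimes_{\phi_*}(y',a')=(y*y',\,a+\phi_{*y}(a')),\qquad (y,a)\circ_\xi(y',a')=\bigl(y\circ y',\ \xi_{y\circ y'}(\xi_y^{-1}(a)+\phi_{\circ y}(\xi_{y'}^{-1}(a')))\bigr),$$ and this split sequence lies in the category of left skew braces.
   Context: A left skew brace is a set $X$ with two group structures $(X,*,\circ)$ such that $a\circ(b*c)=(a\circ b)*a^{-*}*(a\circ c)$ for all $a,b,c$, where $a^{-*}$ is the inverse for $*$ (and $a^{-\circ}$ the inverse for $\circ$); the two units coincide. Morphisms are maps that are homomorphisms for both laws. Put $\lambda_a(b)=a^{-*}*(a\circ b)$. An ideal of $(G,*,\circ)$ is a sub-skew brace $K$ with $(K,\circ)$ normal in $(G,\circ)$, $K*a=a*K$ and $\lambda_a(K)\subset K$ for all $a\in G$. The subobject $\{(k_f(-a),k_{f'}(a))\}$ of $X\times_YX'$ is an ideal when the two sequences have the same direction. An exact sequence $1\to(A,+,+)\xrightarrow{k}(X,*,\circ)\xrightarrow{f}(Y,*,\circ)\to1$ means that $f$ is a surjective morphism of left skew braces and $k$ is a kernel of $f$ ($k$ is an injective morphism with image $f^{-1}(1)$); identify $A$ with its image. Its direction is the triple $(\phi_*,\phi_\circ,\xi)$ where, for $y\in Y$, $a\in A$ and any $x\in X$ with $f(x)=y$ (the results do not depend on $x$): $\phi_{*y}(a)=x*a*x^{-*}$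 and $\phi_{\circ y}(a)=x\circ a\circ x^{-\circ}$, giving group actions $\phi_*\colon(Y,* )\to\mathrm{Aut}(A,+)$ and $\phi_\circ\colon(Y,\circ)\to\mathrm{Aut}(A,+)$, and $\xi_y(a)=(a\circ x)*x^{-*}$, giving a map $\xi\colon Y\to S_A$ into the permutations of $A$ (the skewing index of the sequence). Two sequences $(k,f)$, $(k',f')$ with middle terms $X,X'$ are isomorphic when there is an isomorphism $h\colon X\to X'$ of left skew braces with $hk=k'$ and $f'h=f$. *)

theory Defs
  imports "HOL-Algebra.Coset"
begin

text \<open>
  The fields inherited from \<^type>\<open>monoid\<close> carry the law written $*$ on paper, \<open>cmult\<close> is the
  second law. The two units of a left skew brace coincide, so there is one unit field.
\<close>

record 'x skew_brace = "'x monoid" +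
  cmult :: "'x \<Rightarrow> 'x \<Rightarrow> 'x" (infixl "\<bullet>\<index>" 70)

definition circ_group :: "'x skew_brace \<Rightarrow> 'x monoid" where
  "circ_group X = \<lparr>carrier = carrier X, mult = cmult X, one = one X\<rparr>"

locale left_skew_brace = group X for X :: "'x skew_brace" (structure) +
  assumes circ_group: "group (circ_group X)"
    and brace: "\<lbrakk>a \<in> carrier X; b \<in> carrier X; c \<in> carrier X\<rbrakk> \<Longrightarrow>
      a \<bullet> (b \<otimes> c) = (a \<bullet> b) \<otimes> inv a \<otimes> (a \<bullet> c)"

definition brace_hom :: "'x skew_brace \<Rightarrow> 'z skew_brace \<Rightarrow> ('x \<Rightarrow> 'z) set" where
  "brace_hom X Z = hom X Z \<inter> hom (circ_group X) (circ_group Z)"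

definition brace_lambda :: "'x skew_brace \<Rightarrow> 'x \<Rightarrow> 'x \<Rightarrow> 'x" where
  "brace_lambda X a b = inv\<^bsub>X\<^esub> a \<otimes>\<^bsub>X\<^esub> (a \<bullet>\<^bsub>X\<^esub> b)"

definition brace_ideal :: "'x set \<Rightarrow> 'x skew_brace \<Rightarrow> bool" where
  "brace_ideal K G \<longleftrightarrow>
     left_skew_brace G \<and> subgroup K G \<and> subgroup K (circ_group G) \<and>
     K \<lhd> circ_group G \<and>
     (\<forall>a\<in>carrier G. K #>\<^bsub>G\<^esub> a = a <#\<^bsub>G\<^esub> K) \<and>
     (\<forall>a\<in>carrier G. brace_lambda G a ` K \<subseteq> K)"

text \<open>
  For an ideal the cosets of \<open>K\<close> for the two laws agree, so both quotient laws live on the carrier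
  of the quotient for $*$.
\<close>

definition brace_quotient :: "'x skew_brace \<Rightarrow> 'x set \<Rightarrow> 'x set skew_brace" where
  "brace_quotient G K =
     \<lparr>carrier = carrier (G Mod K), mult = mult (G Mod K), one = one (G Mod K),
      cmult = mult (circ_group G Mod K)\<rparr>"

definition quotient_map :: "'x skew_brace \<Rightarrow> 'x set \<Rightarrow> 'x \<Rightarrow> 'x set" where
  "quotient_map G K x = K #>\<^bsub>G\<^esub> x"

text \<open>An abelian group $(A,+)$, written multiplicatively, gives $(A,+,+)$.\<close>

definition triv_brace :: "'a monoid \<Rightarrow> 'a skew_brace" where
  "triv_brace A = \<lparr>carrier = carrier A, mult = mult A, one = one A, cmult = mult A\<rparr>"

record ('a, 'x, 'y) brace_seq =
  middle :: "'x skew_brace"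
  ker_map :: "'a \<Rightarrow> 'x"
  quo_map :: "'x \<Rightarrow> 'y"

definition exact_brace_seq :: "'a monoid \<Rightarrow> 'y skew_brace \<Rightarrow> ('a, 'x, 'y) brace_seq \<Rightarrow> bool" where
  "exact_brace_seq A Y E \<longleftrightarrow>
     left_skew_brace (triv_brace A) \<and> left_skew_brace (middle E) \<and> left_skew_brace Y \<and>
     quo_map E \<in> brace_hom (middle E) Y \<and>
     quo_map E ` carrier (middle E) = carrier Y \<and>
     ker_map E \<in> brace_hom (triv_brace A) (middle E) \<and>
     inj_on (ker_map E) (carrier A) \<and>
     ker_map E ` carrier A = {x \<in> carrier (middle E). quo_map E x = \<one>\<^bsub>Y\<^esub>}"

text \<open>
  A direction is a triple of functions of which only the values on the carriers matter. Since
  \<open>ker_map E\<close> is injective on the carrier of \<open>A\<close>, the conditions below determine these values.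
\<close>

definition has_direction ::
  "'a monoid \<Rightarrow> 'y skew_brace \<Rightarrow> ('a, 'x, 'y) brace_seq \<Rightarrow>
   ('y \<Rightarrow> 'a \<Rightarrow> 'a) \<Rightarrow> ('y \<Rightarrow> 'a \<Rightarrow> 'a) \<Rightarrow> ('y \<Rightarrow> 'a \<Rightarrow> 'a) \<Rightarrow> bool" where
  "has_direction A Y E \<phi>s \<phi>c \<xi> \<longleftrightarrow>
     (let X = middle E; k = ker_map E; f = quo_map E in
      \<forall>y\<in>carrier Y. \<forall>a\<in>carrier A.
        \<phi>s y a \<in> carrier A \<and> \<phi>c y a \<in> carrier A \<and> \<xi> y a \<in> carrier A \<and>
        (\<forall>x\<in>carrier X. f x = y \<longrightarrow>
           k (\<phi>s y a) = x \<otimes>\<^bsub>X\<^esub> k a \<otimes>\<^bsub>X\<^esub> inv\<^bsub>X\<^esub> x \<and>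
           k (\<phi>c y a) = x \<bullet>\<^bsub>X\<^esub> k a \<bullet>\<^bsub>X\<^esub> inv\<^bsub>circ_group X\<^esub> x \<and>
           k (\<xi> y a) = (k a \<bullet>\<^bsub>X\<^esub> x) \<otimes>\<^bsub>X\<^esub> inv\<^bsub>X\<^esub> x))"

definition brace_exts ::
  "'a monoid \<Rightarrow> 'y skew_brace \<Rightarrow> ('y \<Rightarrow> 'a \<Rightarrow> 'a) \<Rightarrow> ('y \<Rightarrow> 'a \<Rightarrow> 'a) \<Rightarrow> ('y \<Rightarrow> 'a \<Rightarrow> 'a) \<Rightarrow>
   ('a, 'x, 'y) brace_seq set" where
  "brace_exts A Y \<phi>s \<phi>c \<xi> = {E. exact_brace_seq A Y E \<and> has_direction A Y E \<phi>s \<phi>c \<xi>}"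

definition seq_iso ::
  "'a monoid \<Rightarrow> ('a, 'x, 'y) brace_seq \<Rightarrow> ('a, 'z, 'y) brace_seq \<Rightarrow> bool" where
  "seq_iso A E F \<longleftrightarrow>
     (\<exists>h. h \<in> brace_hom (middle E) (middle F) \<and>
          bij_betw h (carrier (middle E)) (carrier (middle F)) \<and>
          (\<forall>a\<in>carrier A. h (ker_map E a) = ker_map F a) \<and>
          (\<forall>x\<in>carrier (middle E). quo_map F (h x) = quo_map E x))"

definition fibre_product ::
  "('a, 'x, 'y) brace_seq \<Rightarrow> ('a, 'z, 'y) brace_seq \<Rightarrow> ('x \<times> 'z) skew_brace" where
  "fibre_product E F =
     \<lparr>carrier = {(x, x'). x \<in> carrier (middle E) \<and> x' \<in> carrier (middle F) \<and>
                          quo_map E x = quo_map F x'},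
      mult = (\<lambda>(x, x') (z, z'). (x \<otimes>\<^bsub>middle E\<^esub> z, x' \<otimes>\<^bsub>middle F\<^esub> z')),
      one = (\<one>\<^bsub>middle E\<^esub>, \<one>\<^bsub>middle F\<^esub>),
      cmult = (\<lambda>(x, x') (z, z'). (x \<bullet>\<^bsub>middle E\<^esub> z, x' \<bullet>\<^bsub>middle F\<^esub> z'))\<rparr>"

definition antidiagonal ::
  "'a monoid \<Rightarrow> ('a, 'x, 'y) brace_seq \<Rightarrow> ('a, 'z, 'y) brace_seq \<Rightarrow> ('x \<times> 'z) set" where
  "antidiagonal A E F = {(ker_map E (inv\<^bsub>A\<^esub> a), ker_map F a) | a. a \<in> carrier A}"

definition baer_quotient_map ::
  "'a monoid \<Rightarrow> ('a, 'x, 'y) brace_seq \<Rightarrow> ('a, 'z, 'y) brace_seq \<Rightarrow> 'x \<times> 'z \<Rightarrow> ('x \<times> 'z) set" where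
  "baer_quotient_map A E F = quotient_map (fibre_product E F) (antidiagonal A E F)"

definition baer_sum ::
  "'a monoid \<Rightarrow> ('a, 'x, 'y) brace_seq \<Rightarrow> ('a, 'z, 'y) brace_seq \<Rightarrow> ('a, ('x \<times> 'z) set, 'y) brace_seq"
  where
  "baer_sum A E F =
     \<lparr>middle = brace_quotient (fibre_product E F) (antidiagonal A E F),
      ker_map = (\<lambda>a. baer_quotient_map A E F (\<one>\<^bsub>middle E\<^esub>, ker_map F a)),
      quo_map = (\<lambda>C. the_elem ((\<lambda>(x, x'). quo_map E x) ` C))\<rparr>"

definition neg_seq :: "'a monoid \<Rightarrow> ('a, 'x, 'y) brace_seq \<Rightarrow> ('a, 'x, 'y) brace_seq" where
  "neg_seq A E = E\<lparr>ker_map := (\<lambda>a. ker_map E (inv\<^bsub>A\<^esub> a))\<rparr>"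

definition split_brace ::
  "'a monoid \<Rightarrow> 'y skew_brace \<Rightarrow> ('y \<Rightarrow> 'a \<Rightarrow> 'a) \<Rightarrow> ('y \<Rightarrow> 'a \<Rightarrow> 'a) \<Rightarrow> ('y \<Rightarrow> 'a \<Rightarrow> 'a) \<Rightarrow>
   ('y \<times> 'a) skew_brace" where
  "split_brace A Y \<phi>s \<phi>c \<xi> =
     \<lparr>carrier = carrier Y \<times> carrier A,
      mult = (\<lambda>(y, a) (y', a'). (y \<otimes>\<^bsub>Y\<^esub> y', a \<otimes>\<^bsub>A\<^esub> \<phi>s y a')),
      one = (\<one>\<^bsub>Y\<^esub>, \<one>\<^bsub>A\<^esub>),
      cmult = (\<lambda>(y, a) (y', a').
        (y \<bullet>\<^bsub>Y\<^esub> y',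
         \<xi> (y \<bullet>\<^bsub>Y\<^esub> y')
           (inv_into (carrier A) (\<xi> y) a \<otimes>\<^bsub>A\<^esub> \<phi>c y (inv_into (carrier A) (\<xi> y') a'))))\<rparr>"

definition split_seq ::
  "'a monoid \<Rightarrow> 'y skew_brace \<Rightarrow> ('y \<Rightarrow> 'a \<Rightarrow> 'a) \<Rightarrow> ('y \<Rightarrow> 'a \<Rightarrow> 'a) \<Rightarrow> ('y \<Rightarrow> 'a \<Rightarrow> 'a) \<Rightarrow>
   ('a, 'y \<times> 'a, 'y) brace_seq" where
  "split_seq A Y \<phi>s \<phi>c \<xi> =
     \<lparr>middle = split_brace A Y \<phi>s \<phi>c \<xi>, ker_map = (\<lambda>a. (\<one>\<^bsub>Y\<^esub>, a)), quo_map = fst\<rparr>"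

text \<open>
  A set of isomorphism classes needs a fixed type for the middle terms. The middle term of an exact
  sequence is equipotent to the product of the carriers of \<open>Y\<close> and \<open>A\<close>, so the type
  \<open>'y \<times> 'a\<close> contains a representative of every class. The class of a sequence
  whose middle term lives on an arbitrary type is the set of its isomorphic copies on \<open>'y \<times> 'a\<close>.
\<close>

definition seq_class ::
  "'a monoid \<Rightarrow> 'y skew_brace \<Rightarrow> ('y \<Rightarrow> 'a \<Rightarrow> 'a) \<Rightarrow> ('y \<Rightarrow> 'a \<Rightarrow> 'a) \<Rightarrow> ('y \<Rightarrow> 'a \<Rightarrow> 'a) \<Rightarrow>
   ('a, 'x, 'y) brace_seq \<Rightarrow> ('a, 'y \<times> 'a, 'y) brace_seq set" where
  "seq_class A Y \<phi>s \<phi>c \<xi> E = {F \<in> brace_exts A Y \<phi>s \<phi>c \<xi>. seq_iso A E F}"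

definition seq_iso_rel ::
  "'a monoid \<Rightarrow> 'y skew_brace \<Rightarrow> ('y \<Rightarrow> 'a \<Rightarrow> 'a) \<Rightarrow> ('y \<Rightarrow> 'a \<Rightarrow> 'a) \<Rightarrow> ('y \<Rightarrow> 'a \<Rightarrow> 'a) \<Rightarrow>
   ('a, 'y \<times> 'a, 'y) brace_seq rel" where
  "seq_iso_rel A Y \<phi>s \<phi>c \<xi> =
     {(E, F). E \<in> brace_exts A Y \<phi>s \<phi>c \<xi> \<and> F \<in> brace_exts A Y \<phi>s \<phi>c \<xi> \<and> seq_iso A E F}"

text \<open>The product of two classes collects the classes of the Baer sums of all their members.\<close>

definition ext_group ::
  "'a monoid \<Rightarrow> 'y skew_brace \<Rightarrow> ('y \<Rightarrow> 'a \<Rightarrow> 'a) \<Rightarrow> ('y \<Rightarrow> 'a \<Rightarrow> 'a) \<Rightarrow> ('y \<Rightarrow> 'a \<Rightarrow> 'a) \<Rightarrow>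
   ('a, 'y \<times> 'a, 'y) brace_seq set monoid" where
  "ext_group A Y \<phi>s \<phi>c \<xi> =
     \<lparr>carrier = brace_exts A Y \<phi>s \<phi>c \<xi> // seq_iso_rel A Y \<phi>s \<phi>c \<xi>,
      mult = (\<lambda>C D. \<Union>E\<in>C. \<Union>F\<in>D. seq_class A Y \<phi>s \<phi>c \<xi> (baer_sum A E F)),
      one = seq_class A Y \<phi>s \<phi>c \<xi> (split_seq A Y \<phi>s \<phi>c \<xi>)\<rparr>"

end

theory Submission
  imports Defs
begin

text \<open>
  Write every element of a fibre of \<open>f\<close> as \<open>k a * x\<close> for a chosen \<open>x\<close>. In these coordinates both laws of
  an exact sequence depend only on its direction. Hence \<open>(x, k a * x) \<mapsto> (f x, a)\<close> maps the fibre
  square of any sequence onto the split sequence and preserves both laws, which is why the latter is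
  a skew brace; and \<open>((f x, a), x) \<mapsto> k a * x\<close> shows that it is neutral. The Baer sum of two
  sequences is characterised by a universal property: a morphism over \<open>Y\<close> from the fibre product to
  the middle term of \<open>G\<close> which is addition on \<open>A \<times> A\<close> factors through the quotient, and the factor is
  an isomorphism by the short five lemma. Each group law amounts to writing down one such map.
\<close>

section \<open>Skew braces, images and quotients\<close>

text \<open>The obstacle is that the two laws prefer different coordinates. A fibre of
  \<open>f\<close> is a torsor under \<open>A\<close> for each law; commutation with the kernel is
  governed by \<open>\<phi>s\<close> for \<open>\<otimes>\<close> and by \<open>\<phi>c\<close> for
  \<open>\<bullet>\<close>, while \<open>\<xi>\<close> turns the coordinate \<open>a\<close> of
  \<open>k a \<bullet> x\<close> into the coordinate of the same point relative to
  \<open>\<otimes>\<close>. A circle product is therefore computed by undoing \<open>\<xi>\<close>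
  on both factors, acting by \<open>\<phi>c\<close> and applying \<open>\<xi>\<close> again, which
  is where the second law of the split sequence comes from. For arbitrary functions these formulas
  need not define a skew brace, so the argument starts from a sequence that realises the direction.
  The whole direction must also commute with inversion in \<open>A\<close>; otherwise the
  antidiagonal would not be an ideal and a negated kernel map would change the direction. A further
  difficulty is typing: Baer sums live on sets of pairs, whereas the group consists of classes over
  one fixed type, so each sequence has to be carried back to that type.\<close>

lemma circ_group_simps [simp]:
  "carrier (circ_group X) = carrier X"
  "mult (circ_group X) = cmult X"
  "one (circ_group X) = one X"
  by (simp_all add: circ_group_def)

lemma triv_brace_simps [simp]:
  "carrier (triv_brace A) = carrier A"
  "mult (triv_brace A) = mult A"
  "one (triv_brace A) = one A"
  "cmult (triv_brace A) = mult A"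
  by (simp_all add: triv_brace_def)

lemma brace_homI:
  assumes "\<And>x. x \<in> carrier X \<Longrightarrow> h x \<in> carrier Z"
    and "\<And>x y. \<lbrakk>x \<in> carrier X; y \<in> carrier X\<rbrakk> \<Longrightarrow> h (x \<otimes>\<^bsub>X\<^esub> y) = h x \<otimes>\<^bsub>Z\<^esub> h y"
    and "\<And>x y. \<lbrakk>x \<in> carrier X; y \<in> carrier X\<rbrakk> \<Longrightarrow> h (x \<bullet>\<^bsub>X\<^esub> y) = h x \<bullet>\<^bsub>Z\<^esub> h y"
  shows "h \<in> brace_hom X Z"
  using assms by (auto simp: brace_hom_def hom_def)

lemma brace_homD:
  assumes "h \<in> brace_hom X Z"
  shows "x \<in> carrier X \<Longrightarrow> h x \<in> carrier Z"
    and "\<lbrakk>x \<in> carrier X; y \<in> carrier X\<rbrakk> \<Longrightarrow> h (x \<otimes>\<^bsub>X\<^esub> y) = h x \<otimes>\<^bsub>Z\<^esub> h y"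
    and "\<lbrakk>x \<in> carrier X; y \<in> carrier X\<rbrakk> \<Longrightarrow> h (x \<bullet>\<^bsub>X\<^esub> y) = h x \<bullet>\<^bsub>Z\<^esub> h y"
  using assms by (auto simp: brace_hom_def hom_def)

lemma brace_hom_compose:
  assumes "g \<in> brace_hom X Y" and "h \<in> brace_hom Y Z"
  shows "h \<circ> g \<in> brace_hom X Z"
  by (rule brace_homI) (simp_all add: brace_homD[OF assms(1)] brace_homD[OF assms(2)])

section \<open>The circle group and the lambda action\<close>

context left_skew_brace
begin

lemma cmult_closed [simp, intro]:
  "\<lbrakk>x \<in> carrier X; y \<in> carrier X\<rbrakk> \<Longrightarrow> x \<bullet> y \<in> carrier X"
  using monoid.m_closed[OF group.is_monoid[OF circ_group]] by simp

lemma cmult_assoc: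
  "\<lbrakk>x \<in> carrier X; y \<in> carrier X; z \<in> carrier X\<rbrakk> \<Longrightarrow> x \<bullet> y \<bullet> z = x \<bullet> (y \<bullet> z)"
  using monoid.m_assoc[OF group.is_monoid[OF circ_group]] by simp

lemma cmult_one [simp]:
  "x \<in> carrier X \<Longrightarrow> \<one> \<bullet> x = x" "x \<in> carrier X \<Longrightarrow> x \<bullet> \<one> = x"
  using monoid.l_one[OF group.is_monoid[OF circ_group]]
    monoid.r_one[OF group.is_monoid[OF circ_group]] by simp_all

abbreviation cinv where "cinv \<equiv> m_inv (circ_group X)"

lemma cinv_closed [simp, intro]: "x \<in> carrier X \<Longrightarrow> cinv x \<in> carrier X"
  using group.inv_closed[OF circ_group] by simp

lemma cinv_simps [simp]:
  "x \<in> carrier X \<Longrightarrow> cinv x \<bullet> x = \<one>" "x \<in> carrier X \<Longrightarrow> x \<bullet> cinv x = \<one>"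
  using group.l_inv[OF circ_group] group.r_inv[OF circ_group] by simp_all

lemma cmult_eqD:
  assumes "x \<bullet> z = y \<bullet> z" "x \<in> carrier X" "y \<in> carrier X" "z \<in> carrier X"
  shows "x = y"
  using assms group.right_cancel[OF circ_group, of z x y] by simp

lemma lambda_closed [simp, intro]:
  "\<lbrakk>x \<in> carrier X; y \<in> carrier X\<rbrakk> \<Longrightarrow> brace_lambda X x y \<in> carrier X"
  by (simp add: brace_lambda_def)

lemma cmult_eq_mult_lambda:
  "\<lbrakk>x \<in> carrier X; y \<in> carrier X\<rbrakk> \<Longrightarrow> x \<bullet> y = x \<otimes> brace_lambda X x y"
  by (simp add: brace_lambda_def m_assoc[symmetric])

text \<open>The brace identity is equivalent to additivity of \<open>brace_lambda X x\<close> for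
  the first law.\<close>

lemma lambda_mult:
  assumes "x \<in> carrier X" "y \<in> carrier X" "z \<in> carrier X"
  shows "brace_lambda X x (y \<otimes> z) = brace_lambda X x y \<otimes> brace_lambda X x z"
  using assms by (simp add: brace_lambda_def brace m_assoc)

lemma lambda_inv:
  assumes "x \<in> carrier X" "y \<in> carrier X"
  shows "brace_lambda X x (inv y) = inv (brace_lambda X x y)"
proof -
  have "group_hom X X (brace_lambda X x)"
    by (rule group_hom.intro[OF is_group is_group])
      (auto simp: group_hom_axioms_def hom_def lambda_mult assms)
  from group_hom.hom_inv[OF this assms(2)] show ?thesis .
qed

text \<open>With \<open>lambda_mult\<close> and \<open>lambda_one\<close> this makes lambda an
  action of the circle group by automorphisms of the first group. In \<open>cosets_agree\<close> it
  supplies the inverse of \<open>brace_lambda X x\<close>, namely the map belonging to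
  \<open>cinv x\<close>.\<close>

lemma lambda_lambda:
  assumes "x \<in> carrier X" "y \<in> carrier X" "z \<in> carrier X"
  shows "brace_lambda X x (brace_lambda X y z) = brace_lambda X (x \<bullet> y) z"
proof -
  have "brace_lambda X x (brace_lambda X y z)
      = inv (brace_lambda X x y) \<otimes> brace_lambda X x (y \<bullet> z)"
    using assms by (subst brace_lambda_def[of X y]) (simp add: lambda_mult lambda_inv)
  also have "\<dots> = inv (x \<bullet> y) \<otimes> (x \<otimes> (inv x \<otimes> (x \<bullet> (y \<bullet> z))))"
    using assms by (simp add: brace_lambda_def inv_mult_group m_assoc)
  also have "\<dots> = brace_lambda X (x \<bullet> y) z"
    using assms by (simp add: brace_lambda_def m_assoc[symmetric] cmult_assoc)
  finally show ?thesis .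
qed

lemma lambda_one: "x \<in> carrier X \<Longrightarrow> brace_lambda X \<one> x = x"
  by (simp add: brace_lambda_def)

end

section \<open>Homomorphisms, images and factorisation\<close>

lemma brace_hom_one:
  assumes "left_skew_brace X" "left_skew_brace Z" "h \<in> brace_hom X Z"
  shows "h \<one>\<^bsub>X\<^esub> = \<one>\<^bsub>Z\<^esub>"
  using assms hom_one[of h X Z] by (simp add: brace_hom_def left_skew_brace_def)

lemma brace_hom_inv:
  assumes "left_skew_brace X" "left_skew_brace Z" "h \<in> brace_hom X Z" "x \<in> carrier X"
  shows "h (inv\<^bsub>X\<^esub> x) = inv\<^bsub>Z\<^esub> h x"
    and "h (inv\<^bsub>circ_group X\<^esub> x) = inv\<^bsub>circ_group Z\<^esub> h x"
proof -
  interpret X: left_skew_brace X by fact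
  interpret Z: left_skew_brace Z by fact
  have "group_hom X Z h" "group_hom (circ_group X) (circ_group Z) h"
    using assms(3) X.is_group Z.is_group X.circ_group Z.circ_group
    by (simp_all add: brace_hom_def group_hom_def group_hom_axioms_def)
  from group_hom.hom_inv[OF this(1)] group_hom.hom_inv[OF this(2)] assms(4)
  show "h (inv\<^bsub>X\<^esub> x) = inv\<^bsub>Z\<^esub> h x"
    and "h (inv\<^bsub>circ_group X\<^esub> x) = inv\<^bsub>circ_group Z\<^esub> h x" by simp_all
qed

text \<open>Each axiom of \<open>Z\<close> lifts along the surjection to an axiom of
  \<open>X\<close>. The unit is a separate field of the record, so its preservation is a hypothesis
  rather than a consequence.\<close>

lemma left_skew_brace_image:
  assumes "left_skew_brace X" and h: "h \<in> brace_hom X Z"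
    and surj: "h ` carrier X = carrier Z" and one: "h \<one>\<^bsub>X\<^esub> = \<one>\<^bsub>Z\<^esub>"
  shows "left_skew_brace Z"
proof -
  interpret X: left_skew_brace X by fact
  have "group (Z\<lparr>carrier := h ` carrier X, one := h \<one>\<^bsub>X\<^esub>\<rparr>)"
    using X.hom_imp_img_group h by (auto simp: brace_hom_def)
  then interpret Z: group Z using surj one by simp
  have "group ((circ_group Z)\<lparr>carrier := h ` carrier (circ_group X), one := h \<one>\<^bsub>circ_group X\<^esub>\<rparr>)"
    using group.hom_imp_img_group[OF X.circ_group] h by (auto simp: brace_hom_def)
  moreover have "(circ_group Z)\<lparr>carrier := h ` carrier (circ_group X), one := h \<one>\<^bsub>circ_group X\<^esub>\<rparr>
      = circ_group Z"
    using surj one by (simp add: circ_group_def)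
  ultimately have circ: "group (circ_group Z)" by simp
  have "group_hom X Z h"
    using h X.is_group Z.is_group by (simp add: brace_hom_def group_hom_def group_hom_axioms_def)
  note inv = group_hom.hom_inv[OF this]
  show ?thesis
  proof (intro left_skew_brace.intro left_skew_brace_axioms.intro Z.is_group circ)
    fix a b c assume "a \<in> carrier Z" "b \<in> carrier Z" "c \<in> carrier Z"
    then obtain a' b' c' where "a = h a'" "b = h b'" "c = h c'"
      and [simp]: "a' \<in> carrier X" "b' \<in> carrier X" "c' \<in> carrier X"
      using surj by blast
    then show "a \<bullet>\<^bsub>Z\<^esub> (b \<otimes>\<^bsub>Z\<^esub> c) = (a \<bullet>\<^bsub>Z\<^esub> b) \<otimes>\<^bsub>Z\<^esub> inv\<^bsub>Z\<^esub> a \<otimes>\<^bsub>Z\<^esub> (a \<bullet>\<^bsub>Z\<^esub> c)"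
      using X.brace[of a' b' c']
      by (simp add: brace_homD(2,3)[OF h, symmetric] inv[symmetric])
  qed
qed

text \<open>The factor evaluates \<open>q\<close> at any preimage under \<open>p\<close>; constancy
  of \<open>q\<close> on the fibres of \<open>p\<close> makes the choice harmless. Stated for a
  surjection rather than a coset projection, it also serves for inverting an isomorphism and for the
  triple fibre product.\<close>

lemma brace_hom_factor:
  assumes P: "left_skew_brace P" and p: "p \<in> brace_hom P Q" and q: "q \<in> brace_hom P R"
    and surj: "p ` carrier P = carrier Q"
    and fibres: "\<And>u v. \<lbrakk>u \<in> carrier P; v \<in> carrier P; p u = p v\<rbrakk> \<Longrightarrow> q u = q v"
  obtains h where "h \<in> brace_hom Q R" "\<And>u. u \<in> carrier P \<Longrightarrow> h (p u) = q u"
proof -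
  interpret P: left_skew_brace P by fact
  define h where "h = q \<circ> inv_into (carrier P) p"
  have eq: "h (p u) = q u" if "u \<in> carrier P" for u
  proof -
    have "p u \<in> p ` carrier P" using that by simp
    then show ?thesis
      unfolding h_def using that by (auto intro: fibres inv_into_into f_inv_into_f)
  qed
  have "h \<in> brace_hom Q R"
  proof (rule brace_homI)
    fix x assume "x \<in> carrier Q"
    then obtain u where "u \<in> carrier P" "x = p u" using surj by blast
    then show "h x \<in> carrier R" by (simp add: eq brace_homD[OF q])
  next
    fix x y assume "x \<in> carrier Q" "y \<in> carrier Q"
    then obtain u v where uv: "u \<in> carrier P" "x = p u" "v \<in> carrier P" "y = p v"
      using surj by blast
    show "h (x \<otimes>\<^bsub>Q\<^esub> y) = h x \<otimes>\<^bsub>R\<^esub> h y"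
      using uv eq[of "u \<otimes>\<^bsub>P\<^esub> v"] by (simp add: eq brace_homD[OF q] brace_homD[OF p])
    show "h (x \<bullet>\<^bsub>Q\<^esub> y) = h x \<bullet>\<^bsub>R\<^esub> h y"
      using uv eq[of "u \<bullet>\<^bsub>P\<^esub> v"] by (simp add: eq brace_homD[OF q] brace_homD[OF p])
  qed
  then show thesis using eq by (rule that)
qed

section \<open>Quotients by ideals\<close>

locale brace_with_ideal = left_skew_brace +
  fixes K
  assumes ideal: "brace_ideal K X"
begin

lemma normal: "K \<lhd> X"
  using ideal is_group by (simp add: brace_ideal_def normal_def normal_axioms_def)

lemma circ_normal: "K \<lhd> circ_group X"
  using ideal by (simp add: brace_ideal_def)

text \<open>Left cosets agree since \<open>x \<bullet> k\<close> equals
  \<open>x \<otimes> brace_lambda X x k\<close> and each lambda map permutes \<open>K\<close>;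
  normality for both laws passes this on to right cosets.\<close>

lemma cosets_agree:
  assumes x: "x \<in> carrier X"
  shows "K #>\<^bsub>circ_group X\<^esub> x = K #> x"
proof -
  have K: "K \<subseteq> carrier X" using normal by (simp add: normal_imp_subgroup subgroup.subset)
  have lam: "brace_lambda X z k \<in> K" if "z \<in> carrier X" "k \<in> K" for z k
    using ideal that unfolding brace_ideal_def by blast
  have "x <#\<^bsub>circ_group X\<^esub> K = x <# K"
  proof (intro subset_antisym subsetI)
    fix z assume "z \<in> x <#\<^bsub>circ_group X\<^esub> K"
    then show "z \<in> x <# K"
      using lam[OF x] cmult_eq_mult_lambda[OF x] K by (auto simp: l_coset_def)
  next
    fix z assume "z \<in> x <# K"
    then obtain k where k: "k \<in> K" "z = x \<otimes> k" by (auto simp: l_coset_def)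
    then have "k \<in> carrier X" using K by blast
    \<comment> \<open>The witness \<open>brace_lambda X (cinv x) k\<close> is the preimage of
      \<open>k\<close> under \<open>brace_lambda X x\<close>.\<close>
    then have "x \<bullet> brace_lambda X (cinv x) k = x \<otimes> brace_lambda X (x \<bullet> cinv x) k"
      using x by (subst cmult_eq_mult_lambda) (simp_all only: lambda_lambda lambda_closed cinv_closed)
    then have "z = x \<bullet> brace_lambda X (cinv x) k"
      using x k \<open>k \<in> carrier X\<close> by (simp add: lambda_one)
    then show "z \<in> x <#\<^bsub>circ_group X\<^esub> K"
      using lam[of "cinv x" k] x k by (auto simp: l_coset_def)
  qed
  then show ?thesis
    using normal.coset_eq[OF normal] normal.coset_eq[OF circ_normal] x by simp
qed

lemma quotient_map_hom: "quotient_map X K \<in> brace_hom X (brace_quotient X K)"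
proof (rule brace_homI)
  fix x y assume xy: "x \<in> carrier X" "y \<in> carrier X"
  show "quotient_map X K x \<in> carrier (brace_quotient X K)"
    using xy by (auto simp: quotient_map_def brace_quotient_def FactGroup_def RCOSETS_def)
  show "quotient_map X K (x \<otimes> y) = quotient_map X K x \<otimes>\<^bsub>brace_quotient X K\<^esub> quotient_map X K y"
    using xy normal.rcos_sum[OF normal]
    by (simp add: quotient_map_def brace_quotient_def FactGroup_def)
  show "quotient_map X K (x \<bullet> y) = quotient_map X K x \<bullet>\<^bsub>brace_quotient X K\<^esub> quotient_map X K y"
    using xy normal.rcos_sum[OF circ_normal, of x y]
    by (simp add: quotient_map_def brace_quotient_def FactGroup_def cosets_agree)
qed

lemma quotient_map_surj: "quotient_map X K ` carrier X = carrier (brace_quotient X K)"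
  by (auto simp: quotient_map_def brace_quotient_def FactGroup_def RCOSETS_def)

lemma quotient_map_one: "quotient_map X K \<one> = \<one>\<^bsub>brace_quotient X K\<^esub>"
  using coset_mult_one normal_imp_subgroup[OF normal]
  by (simp add: quotient_map_def brace_quotient_def FactGroup_def subgroup.subset)

lemma quotient_map_eq_iff:
  assumes "x \<in> carrier X" "y \<in> carrier X"
  shows "quotient_map X K x = quotient_map X K y \<longleftrightarrow> (\<exists>k\<in>K. x = k \<otimes> y)"
proof -
  have K: "subgroup K X" using normal by (rule normal_imp_subgroup)
  have "K #> x = K #> y \<longleftrightarrow> x \<in> K #> y"
    using assms K repr_independence rcos_self by metis
  then show ?thesis by (auto simp: quotient_map_def r_coset_def)
qed

end

section \<open>Exact sequences with a given direction\<close>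

text \<open>Exactness only requires \<open>triv_brace A\<close> to be a skew brace, and two equal
  laws satisfy the brace identity over any group; commutativity of \<open>A\<close> is therefore a
  separate assumption.\<close>

locale brace_ext =
  fixes A :: "'a monoid" and Y :: "'y skew_brace"
    and \<phi>s \<phi>c \<xi> :: "'y \<Rightarrow> 'a \<Rightarrow> 'a" and E :: "('a, 'x, 'y) brace_seq"
  assumes A: "comm_group A" and ext: "E \<in> brace_exts A Y \<phi>s \<phi>c \<xi>"
begin

sublocale A: comm_group A by (rule A)
sublocale X: left_skew_brace "middle E" using ext by (simp add: brace_exts_def exact_brace_seq_def)
sublocale Y: left_skew_brace Y using ext by (simp add: brace_exts_def exact_brace_seq_def)

abbreviation X where "X \<equiv> middle E"
abbreviation f where "f \<equiv> quo_map E"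
abbreviation k where "k \<equiv> ker_map E"

lemma triv: "left_skew_brace (triv_brace A)"
  using ext by (simp add: brace_exts_def exact_brace_seq_def)

lemma f_hom: "f \<in> brace_hom X Y" and k_hom: "k \<in> brace_hom (triv_brace A) X"
  using ext by (simp_all add: brace_exts_def exact_brace_seq_def)

lemmas f_closed [simp, intro] = brace_homD(1)[OF f_hom]
lemmas f_mult [simp] = brace_homD(2)[OF f_hom]
lemmas f_cmult [simp] = brace_homD(3)[OF f_hom]
lemmas f_one [simp] = brace_hom_one[OF X.left_skew_brace_axioms Y.left_skew_brace_axioms f_hom]
lemmas f_inv [simp] = brace_hom_inv(1)[OF X.left_skew_brace_axioms Y.left_skew_brace_axioms f_hom]
lemmas f_cinv [simp] = brace_hom_inv(2)[OF X.left_skew_brace_axioms Y.left_skew_brace_axioms f_hom]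
lemmas k_closed [simp, intro] = brace_homD(1)[OF k_hom, simplified]
lemmas k_mult = brace_homD(2)[OF k_hom, simplified]
lemmas k_cmult = brace_homD(3)[OF k_hom, simplified]
lemmas k_one [simp] = brace_hom_one[OF triv X.left_skew_brace_axioms k_hom, simplified]

lemma k_inv: "a \<in> carrier A \<Longrightarrow> k (inv\<^bsub>A\<^esub> a) = inv\<^bsub>X\<^esub> k a"
  by (rule X.inv_equality[symmetric]) (simp_all add: k_mult[symmetric])

lemma f_surj: "f ` carrier X = carrier Y"
  using ext by (simp add: brace_exts_def exact_brace_seq_def)

lemma k_eq_iff [simp]: "\<lbrakk>a \<in> carrier A; b \<in> carrier A\<rbrakk> \<Longrightarrow> k a = k b \<longleftrightarrow> a = b"
  using ext by (auto simp: brace_exts_def exact_brace_seq_def inj_on_def)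

lemma k_image: "k ` carrier A = {x \<in> carrier X. f x = \<one>\<^bsub>Y\<^esub>}"
  using ext by (simp add: brace_exts_def exact_brace_seq_def)

lemma f_k [simp]: "a \<in> carrier A \<Longrightarrow> f (k a) = \<one>\<^bsub>Y\<^esub>"
proof -
  assume "a \<in> carrier A"
  then have "k a \<in> {x \<in> carrier X. f x = \<one>\<^bsub>Y\<^esub>}" unfolding k_image[symmetric] by (rule imageI)
  then show ?thesis by simp
qed

lemma direction_closed [simp, intro]:
  assumes "y \<in> carrier Y" "a \<in> carrier A"
  shows "\<phi>s y a \<in> carrier A" "\<phi>c y a \<in> carrier A" "\<xi> y a \<in> carrier A"
  using ext assms by (simp_all add: brace_exts_def has_direction_def Let_def)

text \<open>In this and the next two lemmas the inverses in the definition of the direction are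
  cancelled. What remains are rules for moving \<open>k a\<close> past \<open>x\<close> and for
  exchanging one law for the other.\<close>

lemma mult_k:
  assumes "x \<in> carrier X" "a \<in> carrier A"
  shows "x \<otimes>\<^bsub>X\<^esub> k a = k (\<phi>s (f x) a) \<otimes>\<^bsub>X\<^esub> x"
proof -
  have "k (\<phi>s (f x) a) = x \<otimes>\<^bsub>X\<^esub> k a \<otimes>\<^bsub>X\<^esub> inv\<^bsub>X\<^esub> x"
    using ext assms f_closed by (simp add: brace_exts_def has_direction_def Let_def)
  then show ?thesis using assms by (simp add: X.m_assoc)
qed

lemma cmult_k:
  assumes "x \<in> carrier X" "a \<in> carrier A"
  shows "x \<bullet>\<^bsub>X\<^esub> k a = k (\<phi>c (f x) a) \<bullet>\<^bsub>X\<^esub> x"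
proof -
  have "k (\<phi>c (f x) a) = x \<bullet>\<^bsub>X\<^esub> k a \<bullet>\<^bsub>X\<^esub> X.cinv x"
    using ext assms f_closed by (simp add: brace_exts_def has_direction_def Let_def)
  then show ?thesis using assms by (simp add: X.cmult_assoc)
qed

lemma k_cmult_eq_mult:
  assumes "x \<in> carrier X" "a \<in> carrier A"
  shows "k a \<bullet>\<^bsub>X\<^esub> x = k (\<xi> (f x) a) \<otimes>\<^bsub>X\<^esub> x"
proof -
  have "k (\<xi> (f x) a) = (k a \<bullet>\<^bsub>X\<^esub> x) \<otimes>\<^bsub>X\<^esub> inv\<^bsub>X\<^esub> x"
    using ext assms f_closed by (simp add: brace_exts_def has_direction_def Let_def)
  then show ?thesis using assms by (simp add: X.m_assoc)
qed

lemma fibre_mult: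
  assumes "x \<in> carrier X" "z \<in> carrier X" "f x = f z"
  obtains a where "a \<in> carrier A" "x = k a \<otimes>\<^bsub>X\<^esub> z"
proof -
  have "x \<otimes>\<^bsub>X\<^esub> inv\<^bsub>X\<^esub> z \<in> k ` carrier A" using assms by (simp add: k_image)
  then obtain a where "a \<in> carrier A" "x \<otimes>\<^bsub>X\<^esub> inv\<^bsub>X\<^esub> z = k a" by blast
  then show thesis using assms
    by (metis X.inv_solve_right' k_closed that)
qed

text \<open>A fibre is a torsor under the kernel for either law; in general \<open>a\<close> is not
  the element that \<open>fibre_mult\<close> finds for the same two points.\<close>

lemma fibre_cmult:
  assumes "x \<in> carrier X" "z \<in> carrier X" "f x = f z"
  obtains a where "a \<in> carrier A" "x = k a \<bullet>\<^bsub>X\<^esub> z"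
proof -
  have "f (x \<bullet>\<^bsub>X\<^esub> X.cinv z) = \<one>\<^bsub>Y\<^esub>" using assms by simp
  then have "x \<bullet>\<^bsub>X\<^esub> X.cinv z \<in> k ` carrier A" using assms(1,2) by (simp add: k_image)
  then obtain a where a: "a \<in> carrier A" "k a = x \<bullet>\<^bsub>X\<^esub> X.cinv z" by fastforce
  have "x = k a \<bullet>\<^bsub>X\<^esub> z" using a assms by (simp add: X.cmult_assoc)
  then show thesis using a(1) that by blast
qed

lemma fibre_nonempty:
  assumes "y \<in> carrier Y"
  obtains x where "x \<in> carrier X" "f x = y"
proof -
  from assms have "y \<in> f ` carrier X" by (simp add: f_surj)
  then show thesis by (rule imageE) (rule that, simp_all)
qed

text \<open>For fixed \<open>x\<close> over \<open>y\<close>, both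
  \<open>a \<mapsto> k a \<bullet> x\<close> and \<open>a \<mapsto> k a \<otimes> x\<close> are
  bijections from \<open>A\<close> onto the fibre, and \<open>\<xi> y\<close> is the transition
  between them.\<close>

lemma xi_bij:
  assumes y: "y \<in> carrier Y"
  shows "bij_betw (\<xi> y) (carrier A) (carrier A)"
proof -
  obtain x where x: "x \<in> carrier X" "f x = y" using y by (rule fibre_nonempty)
  have "inj_on (\<xi> y) (carrier A)"
  proof (rule inj_onI)
    fix a b assume ab: "a \<in> carrier A" "b \<in> carrier A" "\<xi> y a = \<xi> y b"
    then have "k a \<bullet>\<^bsub>X\<^esub> x = k b \<bullet>\<^bsub>X\<^esub> x" using x by (simp add: k_cmult_eq_mult)
    then show "a = b" using X.cmult_eqD[of "k a" x "k b"] ab x by simp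
  qed
  moreover have "b \<in> \<xi> y ` carrier A" if b: "b \<in> carrier A" for b
  proof -
    obtain a where a: "a \<in> carrier A" "k b \<otimes>\<^bsub>X\<^esub> x = k a \<bullet>\<^bsub>X\<^esub> x"
      by (rule fibre_cmult[of "k b \<otimes>\<^bsub>X\<^esub> x" x]) (use x b y in simp_all)
    then have "b = \<xi> y a" using x b y by (simp add: k_cmult_eq_mult)
    then show ?thesis using a by blast
  qed
  ultimately show ?thesis using y by (auto simp: bij_betw_def)
qed

abbreviation \<eta> where "\<eta> y \<equiv> inv_into (carrier A) (\<xi> y)"

lemma eta_closed [simp, intro]: "\<lbrakk>y \<in> carrier Y; a \<in> carrier A\<rbrakk> \<Longrightarrow> \<eta> y a \<in> carrier A"
  using bij_betw_apply[OF bij_betw_inv_into[OF xi_bij]] .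

lemma xi_eta: "\<lbrakk>y \<in> carrier Y; a \<in> carrier A\<rbrakk> \<Longrightarrow> \<xi> y (\<eta> y a) = a"
  using bij_betw_inv_into_right[OF xi_bij] .

lemma k_mult_eq_cmult:
  assumes "x \<in> carrier X" "a \<in> carrier A"
  shows "k a \<otimes>\<^bsub>X\<^esub> x = k (\<eta> (f x) a) \<bullet>\<^bsub>X\<^esub> x"
  using assms by (simp add: k_cmult_eq_mult xi_eta)

text \<open>Relative to a fixed pair \<open>(x, z)\<close>, both laws of the middle term are those of the split
  sequence.\<close>

lemma mult_in_fibres:
  assumes "x \<in> carrier X" "z \<in> carrier X" "a \<in> carrier A" "b \<in> carrier A"
  shows "(k a \<otimes>\<^bsub>X\<^esub> x) \<otimes>\<^bsub>X\<^esub> (k b \<otimes>\<^bsub>X\<^esub> z) = k (a \<otimes>\<^bsub>A\<^esub> \<phi>s (f x) b) \<otimes>\<^bsub>X\<^esub> (x \<otimes>\<^bsub>X\<^esub> z)"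
proof -
  have "(k a \<otimes>\<^bsub>X\<^esub> x) \<otimes>\<^bsub>X\<^esub> (k b \<otimes>\<^bsub>X\<^esub> z) = k a \<otimes>\<^bsub>X\<^esub> (x \<otimes>\<^bsub>X\<^esub> k b) \<otimes>\<^bsub>X\<^esub> z"
    using assms by (simp add: X.m_assoc)
  then show ?thesis using assms unfolding mult_k[OF assms(1,4)] by (simp add: k_mult X.m_assoc)
qed

lemma cmult_in_fibres:
  assumes "x \<in> carrier X" "z \<in> carrier X" "a \<in> carrier A" "b \<in> carrier A"
  shows "(k a \<otimes>\<^bsub>X\<^esub> x) \<bullet>\<^bsub>X\<^esub> (k b \<otimes>\<^bsub>X\<^esub> z)
    = k (\<xi> (f x \<bullet>\<^bsub>Y\<^esub> f z) (\<eta> (f x) a \<otimes>\<^bsub>A\<^esub> \<phi>c (f x) (\<eta> (f z) b))) \<otimes>\<^bsub>X\<^esub> (x \<bullet>\<^bsub>X\<^esub> z)"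
proof -
  define a' b' where ab: "a' = \<eta> (f x) a" "b' = \<eta> (f z) b"
  then have [simp]: "a' \<in> carrier A" "b' \<in> carrier A" using assms by auto
  \<comment> \<open>Both factors pass to coordinates for the second law, the only ones in which
    \<open>cmult_k\<close> can commute \<open>k b'\<close> past \<open>x\<close>; the last step
    returns through \<open>\<xi>\<close>.\<close>
  have "(k a \<otimes>\<^bsub>X\<^esub> x) \<bullet>\<^bsub>X\<^esub> (k b \<otimes>\<^bsub>X\<^esub> z) = (k a' \<bullet>\<^bsub>X\<^esub> x) \<bullet>\<^bsub>X\<^esub> (k b' \<bullet>\<^bsub>X\<^esub> z)"
    using assms by (simp only: k_mult_eq_cmult ab)
  also have "\<dots> = k a' \<bullet>\<^bsub>X\<^esub> (x \<bullet>\<^bsub>X\<^esub> k b') \<bullet>\<^bsub>X\<^esub> z"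
    using assms by (simp add: X.cmult_assoc)
  also have "\<dots> = k (a' \<otimes>\<^bsub>A\<^esub> \<phi>c (f x) b') \<bullet>\<^bsub>X\<^esub> (x \<bullet>\<^bsub>X\<^esub> z)"
    using assms unfolding cmult_k[OF assms(1) \<open>b' \<in> carrier A\<close>]
    by (simp add: k_cmult X.cmult_assoc)
  finally show ?thesis using assms by (simp add: k_cmult_eq_mult flip: ab)
qed

text \<open>Additive maps commute with inversion. \<open>\<phi>s\<close> and \<open>\<phi>c\<close>
  are additive as conjugations; for \<open>\<xi> y\<close>, introduced as a mere permutation,
  additivity comes from the brace identity and the commutativity of \<open>A\<close>.\<close>

lemma phi_s_inv: "\<lbrakk>y \<in> carrier Y; a \<in> carrier A\<rbrakk> \<Longrightarrow> \<phi>s y (inv\<^bsub>A\<^esub> a) = inv\<^bsub>A\<^esub> \<phi>s y a"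
  and phi_c_inv: "\<lbrakk>y \<in> carrier Y; a \<in> carrier A\<rbrakk> \<Longrightarrow> \<phi>c y (inv\<^bsub>A\<^esub> a) = inv\<^bsub>A\<^esub> \<phi>c y a"
  and xi_inv: "\<lbrakk>y \<in> carrier Y; a \<in> carrier A\<rbrakk> \<Longrightarrow> \<xi> y (inv\<^bsub>A\<^esub> a) = inv\<^bsub>A\<^esub> \<xi> y a"
proof -
  have gh: "h (inv\<^bsub>A\<^esub> a) = inv\<^bsub>A\<^esub> h a"
    if "a \<in> carrier A" "\<And>a. a \<in> carrier A \<Longrightarrow> h a \<in> carrier A"
      "\<And>a b. \<lbrakk>a \<in> carrier A; b \<in> carrier A\<rbrakk> \<Longrightarrow> h (a \<otimes>\<^bsub>A\<^esub> b) = h a \<otimes>\<^bsub>A\<^esub> h b" for h a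
  proof -
    have "group_hom A A h"
      using that by (auto simp: group_hom_def group_hom_axioms_def hom_def A.is_group)
    from group_hom.hom_inv[OF this that(1)] show ?thesis .
  qed
  assume y: "y \<in> carrier Y" and a: "a \<in> carrier A"
  obtain x where x [simp]: "x \<in> carrier X" and fx: "f x = y" using y by (rule fibre_nonempty)
  show "\<phi>s y (inv\<^bsub>A\<^esub> a) = inv\<^bsub>A\<^esub> \<phi>s y a"
  proof (rule gh[OF a])
    fix a b assume ab: "a \<in> carrier A" "b \<in> carrier A"
    have "k (\<phi>s y (a \<otimes>\<^bsub>A\<^esub> b)) \<otimes>\<^bsub>X\<^esub> x = k (\<phi>s y a \<otimes>\<^bsub>A\<^esub> \<phi>s y b) \<otimes>\<^bsub>X\<^esub> x"
      using ab y mult_k[of x "a \<otimes>\<^bsub>A\<^esub> b"] X.m_assoc[of x "k a" "k b"] mult_k[of x a] mult_k[of x b]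
      by (simp add: k_mult fx X.m_assoc)
    then show "\<phi>s y (a \<otimes>\<^bsub>A\<^esub> b) = \<phi>s y a \<otimes>\<^bsub>A\<^esub> \<phi>s y b" using ab y by simp
  qed (use y in auto)
  show "\<phi>c y (inv\<^bsub>A\<^esub> a) = inv\<^bsub>A\<^esub> \<phi>c y a"
  proof (rule gh[OF a])
    fix a b assume ab: "a \<in> carrier A" "b \<in> carrier A"
    have "k (\<phi>c y (a \<otimes>\<^bsub>A\<^esub> b)) \<bullet>\<^bsub>X\<^esub> x = k (\<phi>c y a \<otimes>\<^bsub>A\<^esub> \<phi>c y b) \<bullet>\<^bsub>X\<^esub> x"
      using ab y cmult_k[of x "a \<otimes>\<^bsub>A\<^esub> b"] X.cmult_assoc[of x "k a" "k b"] cmult_k[of x a] cmult_k[of x b]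
      by (simp add: k_cmult fx X.cmult_assoc)
    then show "\<phi>c y (a \<otimes>\<^bsub>A\<^esub> b) = \<phi>c y a \<otimes>\<^bsub>A\<^esub> \<phi>c y b"
      using ab y X.cmult_eqD[of _ x] by (metis A.m_closed direction_closed(2) k_closed k_eq_iff x)
  qed (use y in auto)
  show "\<xi> y (inv\<^bsub>A\<^esub> a) = inv\<^bsub>A\<^esub> \<xi> y a"
  proof (rule gh[OF a])
    fix a b assume ab: "a \<in> carrier A" "b \<in> carrier A"
    have "k (\<xi> y (a \<otimes>\<^bsub>A\<^esub> b)) \<otimes>\<^bsub>X\<^esub> x = k a \<bullet>\<^bsub>X\<^esub> (k b \<bullet>\<^bsub>X\<^esub> x)"
      using ab k_cmult_eq_mult[of x "a \<otimes>\<^bsub>A\<^esub> b"] fx by (simp add: k_cmult X.cmult_assoc)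
    \<comment> \<open>by the brace identity, since the two laws agree on the image of \<open>k\<close>\<close>
    also have "\<dots> = (k a \<bullet>\<^bsub>X\<^esub> k (\<xi> y b)) \<otimes>\<^bsub>X\<^esub> inv\<^bsub>X\<^esub> (k a) \<otimes>\<^bsub>X\<^esub> (k a \<bullet>\<^bsub>X\<^esub> x)"
      using ab y by (simp add: k_cmult_eq_mult[of x b] fx X.brace)
    \<comment> \<open>Commuting \<open>\<xi> y b\<close> past \<open>a\<close> lets \<open>a\<close>
      cancel against its inverse.\<close>
    also have "\<dots> = k (\<xi> y b \<otimes>\<^bsub>A\<^esub> a \<otimes>\<^bsub>A\<^esub> inv\<^bsub>A\<^esub> a) \<otimes>\<^bsub>X\<^esub> (k (\<xi> y a) \<otimes>\<^bsub>X\<^esub> x)"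
      using ab y
      by (simp add: k_cmult_eq_mult[of x a] fx A.m_comm[of a "\<xi> y b"] flip: k_cmult[of a] k_inv k_mult)
    also have "\<dots> = k (\<xi> y a \<otimes>\<^bsub>A\<^esub> \<xi> y b) \<otimes>\<^bsub>X\<^esub> x"
      using ab y by (simp add: A.m_assoc k_mult X.m_assoc[symmetric])
        (simp add: A.m_comm flip: k_mult)
    finally show "\<xi> y (a \<otimes>\<^bsub>A\<^esub> b) = \<xi> y a \<otimes>\<^bsub>A\<^esub> \<xi> y b" using ab y by simp
  qed (use y in auto)
qed

end

text \<open>All conditions are imposed on \<open>P\<close>, so nothing needs to be known about the laws of the middle term.\<close>

lemma brace_exts_surjI:
  assumes T: "left_skew_brace (triv_brace A)" and P: "left_skew_brace P" and Y: "left_skew_brace Y"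
    and \<kappa>: "\<kappa> \<in> brace_hom (triv_brace A) P"
    and g: "g \<in> brace_hom P Y" and g_surj: "g ` carrier P = carrier Y"
    and closed: "\<And>y a. \<lbrakk>y \<in> carrier Y; a \<in> carrier A\<rbrakk> \<Longrightarrow>
      \<phi>s y a \<in> carrier A \<and> \<phi>c y a \<in> carrier A \<and> \<xi> y a \<in> carrier A"
    and dir: "\<And>u a. \<lbrakk>u \<in> carrier P; a \<in> carrier A\<rbrakk> \<Longrightarrow>
      u \<otimes>\<^bsub>P\<^esub> \<kappa> a = \<kappa> (\<phi>s (g u) a) \<otimes>\<^bsub>P\<^esub> u \<and> u \<bullet>\<^bsub>P\<^esub> \<kappa> a = \<kappa> (\<phi>c (g u) a) \<bullet>\<^bsub>P\<^esub> u \<and>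
      \<kappa> a \<bullet>\<^bsub>P\<^esub> u = \<kappa> (\<xi> (g u) a) \<otimes>\<^bsub>P\<^esub> u"
    and p: "p \<in> brace_hom P (middle E)" and p_surj: "p ` carrier P = carrier (middle E)"
    and p_one: "p \<one>\<^bsub>P\<^esub> = \<one>\<^bsub>middle E\<^esub>"
    and ker_map: "\<And>a. a \<in> carrier A \<Longrightarrow> ker_map E a = p (\<kappa> a)"
    and quo_map: "\<And>u. u \<in> carrier P \<Longrightarrow> quo_map E (p u) = g u"
    and inj: "\<And>a b. \<lbrakk>a \<in> carrier A; b \<in> carrier A; p (\<kappa> a) = p (\<kappa> b)\<rbrakk> \<Longrightarrow> a = b"
    and ker: "\<And>u. u \<in> carrier P \<Longrightarrow> g u = \<one>\<^bsub>Y\<^esub> \<longleftrightarrow> (\<exists>a\<in>carrier A. p u = p (\<kappa> a))"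
  shows "E \<in> brace_exts A Y \<phi>s \<phi>c \<xi>"
proof -
  interpret P: left_skew_brace P by fact
  have E: "left_skew_brace (middle E)" using left_skew_brace_image[OF P p p_surj p_one] .
  interpret X: left_skew_brace "middle E" by fact
  interpret T: left_skew_brace "triv_brace A" by fact
  have A_closed: "a \<otimes>\<^bsub>A\<^esub> b \<in> carrier A" if "a \<in> carrier A" "b \<in> carrier A" for a b
    using T.m_closed that by simp
  note p_simps = brace_homD[OF p] and g_simps = brace_homD[OF g] and \<kappa>_simps = brace_homD[OF \<kappa>, simplified]
  have surj: "\<exists>u\<in>carrier P. x = p u" if "x \<in> carrier (middle E)" for x using that p_surj by blast
  have quo_hom: "quo_map E \<in> brace_hom (middle E) Y"
  proof (rule brace_homI)
    fix x y assume x: "x \<in> carrier (middle E)" then show "quo_map E x \<in> carrier Y"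
      using surj[OF x] quo_map g_simps(1) by auto
    assume y: "y \<in> carrier (middle E)"
    obtain u v where uv: "u \<in> carrier P" "x = p u" "v \<in> carrier P" "y = p v"
      using surj x y by blast
    show "quo_map E (x \<otimes>\<^bsub>middle E\<^esub> y) = quo_map E x \<otimes>\<^bsub>Y\<^esub> quo_map E y"
      using uv quo_map[of "u \<otimes>\<^bsub>P\<^esub> v"] by (simp add: p_simps g_simps quo_map)
    show "quo_map E (x \<bullet>\<^bsub>middle E\<^esub> y) = quo_map E x \<bullet>\<^bsub>Y\<^esub> quo_map E y"
      using uv quo_map[of "u \<bullet>\<^bsub>P\<^esub> v"] by (simp add: p_simps g_simps quo_map)
  qed
  have ker_hom: "ker_map E \<in> brace_hom (triv_brace A) (middle E)"
  proof (rule brace_homI)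
    fix x y assume x: "x \<in> carrier (triv_brace A)" then show "ker_map E x \<in> carrier (middle E)"
      by (simp add: ker_map p_simps \<kappa>_simps)
    assume y: "y \<in> carrier (triv_brace A)"
    show "ker_map E (x \<otimes>\<^bsub>triv_brace A\<^esub> y) = ker_map E x \<otimes>\<^bsub>middle E\<^esub> ker_map E y"
      using x y by (simp add: ker_map A_closed p_simps \<kappa>_simps(1,2))
    show "ker_map E (x \<bullet>\<^bsub>triv_brace A\<^esub> y) = ker_map E x \<bullet>\<^bsub>middle E\<^esub> ker_map E y"
      using x y \<kappa>_simps(3)[of x y] by (simp add: ker_map A_closed p_simps \<kappa>_simps(1))
  qed
  have quo_surj: "quo_map E ` carrier (middle E) = carrier Y"
    unfolding p_surj[symmetric] g_surj[symmetric] image_image by (rule image_cong) (simp_all add: quo_map)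
  have inj_k: "inj_on (ker_map E) (carrier A)" by (auto intro!: inj_onI inj simp: ker_map)
  have image: "ker_map E ` carrier A = {x \<in> carrier (middle E). quo_map E x = \<one>\<^bsub>Y\<^esub>}"
  proof (intro subset_antisym subsetI)
    fix x assume "x \<in> ker_map E ` carrier A"
    then obtain a where a: "a \<in> carrier A" "x = p (\<kappa> a)" by (auto simp: ker_map)
    then have "g (\<kappa> a) = \<one>\<^bsub>Y\<^esub>" using ker \<kappa>_simps(1) by blast
    then show "x \<in> {x \<in> carrier (middle E). quo_map E x = \<one>\<^bsub>Y\<^esub>}"
      using a by (simp add: p_simps \<kappa>_simps quo_map)
  next
    fix x assume x: "x \<in> {x \<in> carrier (middle E). quo_map E x = \<one>\<^bsub>Y\<^esub>}"
    then obtain u where u: "u \<in> carrier P" "x = p u" using surj by blast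
    then obtain a where "a \<in> carrier A" "x = p (\<kappa> a)" using x ker quo_map by auto
    then show "x \<in> ker_map E ` carrier A" by (auto simp: ker_map)
  qed
  have "exact_brace_seq A Y E"
    unfolding exact_brace_seq_def using T E Y quo_hom ker_hom quo_surj inj_k image by blast
  moreover have "has_direction A Y E \<phi>s \<phi>c \<xi>"
    unfolding has_direction_def Let_def
  proof (intro ballI conjI allI impI)
    fix y a assume y: "y \<in> carrier Y" and a: "a \<in> carrier A"
    note [simp] = closed[OF y a, THEN conjunct1] closed[OF y a, THEN conjunct2, THEN conjunct1]
      closed[OF y a, THEN conjunct2, THEN conjunct2]
    show "\<phi>s y a \<in> carrier A" "\<phi>c y a \<in> carrier A" "\<xi> y a \<in> carrier A" by simp_all
    fix x assume "x \<in> carrier (middle E)" "quo_map E x = y"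
    \<comment> \<open>The lift \<open>u\<close> lies over the same \<open>y\<close>, so the
      identities in \<open>P\<close> can be pushed forward along \<open>p\<close>.\<close>
    then obtain u where u: "u \<in> carrier P" "x = p u" and gu: "g u = y" using surj quo_map by metis
    note d = dir[OF u(1) a, unfolded gu, THEN conjunct1]
      dir[OF u(1) a, unfolded gu, THEN conjunct2, THEN conjunct1]
      dir[OF u(1) a, unfolded gu, THEN conjunct2, THEN conjunct2]
    show "ker_map E (\<phi>s y a) = x \<otimes>\<^bsub>middle E\<^esub> ker_map E a \<otimes>\<^bsub>middle E\<^esub> inv\<^bsub>middle E\<^esub> x"
      using arg_cong[OF d(1), of p] u a by (simp add: p_simps \<kappa>_simps ker_map X.m_assoc)
    show "ker_map E (\<phi>c y a) = x \<bullet>\<^bsub>middle E\<^esub> ker_map E a \<bullet>\<^bsub>middle E\<^esub> X.cinv x"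
      using arg_cong[OF d(2), of p] u a by (simp add: p_simps \<kappa>_simps ker_map X.cmult_assoc)
    show "ker_map E (\<xi> y a) = (ker_map E a \<bullet>\<^bsub>middle E\<^esub> x) \<otimes>\<^bsub>middle E\<^esub> inv\<^bsub>middle E\<^esub> x"
      using arg_cong[OF d(3), of p] u a by (simp add: p_simps \<kappa>_simps ker_map X.m_assoc)
  qed
  ultimately show ?thesis by (simp add: brace_exts_def)
qed

section \<open>The Baer sum\<close>

lemma fibre_product_simps [simp]:
  "(x, x') \<in> carrier (fibre_product E F) \<longleftrightarrow>
    x \<in> carrier (middle E) \<and> x' \<in> carrier (middle F) \<and> quo_map E x = quo_map F x'"
  "(x, x') \<otimes>\<^bsub>fibre_product E F\<^esub> (z, z') = (x \<otimes>\<^bsub>middle E\<^esub> z, x' \<otimes>\<^bsub>middle F\<^esub> z')"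
  "(x, x') \<bullet>\<^bsub>fibre_product E F\<^esub> (z, z') = (x \<bullet>\<^bsub>middle E\<^esub> z, x' \<bullet>\<^bsub>middle F\<^esub> z')"
  "\<one>\<^bsub>fibre_product E F\<^esub> = (\<one>\<^bsub>middle E\<^esub>, \<one>\<^bsub>middle F\<^esub>)"
  by (simp_all add: fibre_product_def)

text \<open>The hypotheses are listed separately, rather than as membership in
  \<open>brace_exts\<close>, because associativity applies the result to a middle term that is
  itself a fibre product, with kernel \<open>A \<times> A\<close> over \<open>Y\<close>.\<close>

lemma fibre_product_left_skew_brace:
  assumes X: "left_skew_brace (middle E)" and X': "left_skew_brace (middle F)"
    and Y: "left_skew_brace Y"
    and f: "quo_map E \<in> brace_hom (middle E) Y" and f': "quo_map F \<in> brace_hom (middle F) Y"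
  shows "left_skew_brace (fibre_product E F)"
proof -
  interpret X: left_skew_brace "middle E" by fact
  interpret X': left_skew_brace "middle F" by fact
  interpret Y: left_skew_brace Y by fact
  note [simp] = brace_homD[OF f] brace_homD[OF f'] brace_hom_one[OF X Y f] brace_hom_one[OF X' Y f']
    brace_hom_inv[OF X Y f] brace_hom_inv[OF X' Y f']
  let ?P = "fibre_product E F"
  have group: "group ?P"
  proof (rule groupI)
    fix u assume u: "u \<in> carrier ?P"
    obtain x x' where [simp]: "u = (x, x')" by fastforce
    show "\<exists>v\<in>carrier ?P. v \<otimes>\<^bsub>?P\<^esub> u = \<one>\<^bsub>?P\<^esub>"
      using u by (intro bexI[of _ "(inv\<^bsub>middle E\<^esub> x, inv\<^bsub>middle F\<^esub> x')"]) simp_all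
  qed (auto simp: X.m_assoc X'.m_assoc)
  have circ: "group (circ_group ?P)"
  proof (rule groupI)
    fix u assume u: "u \<in> carrier (circ_group ?P)"
    obtain x x' where [simp]: "u = (x, x')" by fastforce
    show "\<exists>v\<in>carrier (circ_group ?P). v \<otimes>\<^bsub>circ_group ?P\<^esub> u = \<one>\<^bsub>circ_group ?P\<^esub>"
      using u by (intro bexI[of _ "(X.cinv x, X'.cinv x')"]) simp_all
  qed (auto simp: X.cmult_assoc X'.cmult_assoc)
  have inv: "inv\<^bsub>?P\<^esub> (x, x') = (inv\<^bsub>middle E\<^esub> x, inv\<^bsub>middle F\<^esub> x')"
    if "(x, x') \<in> carrier ?P" for x x'
    by (rule group.inv_equality[OF group]) (use that in simp_all)
  show ?thesis
  proof (intro left_skew_brace.intro left_skew_brace_axioms.intro group circ)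
    fix u v w assume uvw: "u \<in> carrier ?P" "v \<in> carrier ?P" "w \<in> carrier ?P"
    obtain x x' where u: "u = (x, x')" by fastforce
    have "inv\<^bsub>?P\<^esub> u = (inv\<^bsub>middle E\<^esub> x, inv\<^bsub>middle F\<^esub> x')" using inv uvw(1) unfolding u by blast
    then show "u \<bullet>\<^bsub>?P\<^esub> (v \<otimes>\<^bsub>?P\<^esub> w) = (u \<bullet>\<^bsub>?P\<^esub> v) \<otimes>\<^bsub>?P\<^esub> inv\<^bsub>?P\<^esub> u \<otimes>\<^bsub>?P\<^esub> (u \<bullet>\<^bsub>?P\<^esub> w)"
      using uvw unfolding u by (cases v, cases w) (simp add: X.brace X'.brace)
  qed
qed

section \<open>The antidiagonal ideal and its quotient\<close>

locale ext_pair = E: brace_ext A Y \<phi>s \<phi>c \<xi> E + F: brace_ext A Y \<phi>s \<phi>c \<xi> F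
  for A :: "'a monoid" and Y :: "'y skew_brace"
    and \<phi>s \<phi>c \<xi> :: "'y \<Rightarrow> 'a \<Rightarrow> 'a"
    and E :: "('a, 'x, 'y) brace_seq" and F :: "('a, 'z, 'y) brace_seq"
begin

abbreviation P where "P \<equiv> fibre_product E F"
abbreviation N where "N \<equiv> antidiagonal A E F"

sublocale P: left_skew_brace P
  using fibre_product_left_skew_brace[OF E.X.left_skew_brace_axioms F.X.left_skew_brace_axioms
      E.Y.left_skew_brace_axioms E.f_hom F.f_hom] .

text \<open>The two components lie over the same point of \<open>Y\<close> and the directions
  coincide, so the fibre product acts diagonally on \<open>A \<times> A\<close>.\<close>

lemma P_direction:
  assumes "(x, x') \<in> carrier P" "a \<in> carrier A" "b \<in> carrier A"
  shows "(x, x') \<otimes>\<^bsub>P\<^esub> (E.k a, F.k b) = (E.k (\<phi>s (E.f x) a), F.k (\<phi>s (E.f x) b)) \<otimes>\<^bsub>P\<^esub> (x, x')"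
    and "(x, x') \<bullet>\<^bsub>P\<^esub> (E.k a, F.k b) = (E.k (\<phi>c (E.f x) a), F.k (\<phi>c (E.f x) b)) \<bullet>\<^bsub>P\<^esub> (x, x')"
    and "(E.k a, F.k b) \<bullet>\<^bsub>P\<^esub> (x, x') = (E.k (\<xi> (E.f x) a), F.k (\<xi> (E.f x) b)) \<otimes>\<^bsub>P\<^esub> (x, x')"
  using assms E.mult_k[of x a] F.mult_k[of x' b] E.cmult_k[of x a] F.cmult_k[of x' b]
    E.k_cmult_eq_mult[of x a] F.k_cmult_eq_mult[of x' b]
  by simp_all

abbreviation n where "n a \<equiv> (E.k (inv\<^bsub>A\<^esub> a), F.k a)"

lemma N_eq: "N = n ` carrier A"
  by (auto simp: antidiagonal_def)

text \<open>Inversion is an endomorphism of \<open>A\<close> by commutativity. The antidiagonal is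
  thus the image of a homomorphism for both laws, hence a subgroup for both.\<close>

lemma n_hom: "n \<in> brace_hom (triv_brace A) P"
  by (rule brace_homI)
    (simp_all add: E.k_mult F.k_mult E.k_cmult[symmetric] F.k_cmult[symmetric] E.A.inv_mult)

text \<open>Here and in the next two lemmas the direction acts on both coordinates through the same
  map of \<open>A\<close>. As this map commutes with inversion, an antidiagonal pair goes to an
  antidiagonal pair.\<close>

lemma n_conj:
  assumes "u \<in> carrier P" "a \<in> carrier A"
  obtains b where "b \<in> carrier A" "u \<otimes>\<^bsub>P\<^esub> n a = n b \<otimes>\<^bsub>P\<^esub> u"
proof -
  obtain x x' where u: "u = (x, x')" by fastforce
  then have "x \<in> carrier E.X" using assms(1) by simp
  then show thesis
    using P_direction(1)[of x x' "inv\<^bsub>A\<^esub> a" a] assms E.phi_s_inv[of "E.f x" a]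
    by (intro that[of "\<phi>s (E.f x) a"]) (simp_all only: u E.A.inv_closed E.f_closed E.direction_closed)
qed

lemma n_circ_conj:
  assumes "u \<in> carrier P" "a \<in> carrier A"
  obtains b where "b \<in> carrier A" "u \<bullet>\<^bsub>P\<^esub> n a = n b \<bullet>\<^bsub>P\<^esub> u"
proof -
  obtain x x' where u: "u = (x, x')" by fastforce
  then have "x \<in> carrier E.X" using assms(1) by simp
  then show thesis
    using P_direction(2)[of x x' "inv\<^bsub>A\<^esub> a" a] assms E.phi_c_inv[of "E.f x" a]
    by (intro that[of "\<phi>c (E.f x) a"]) (simp_all only: u E.A.inv_closed E.f_closed E.direction_closed)
qed

lemma n_cmult_eq_mult:
  assumes "u \<in> carrier P" "a \<in> carrier A"
  obtains b where "b \<in> carrier A" "n a \<bullet>\<^bsub>P\<^esub> u = n b \<otimes>\<^bsub>P\<^esub> u"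
proof -
  obtain x x' where u: "u = (x, x')" by fastforce
  then have "x \<in> carrier E.X" using assms(1) by simp
  then show thesis
    using P_direction(3)[of x x' "inv\<^bsub>A\<^esub> a" a] assms E.xi_inv[of "E.f x" a]
    by (intro that[of "\<xi> (E.f x) a"]) (simp_all only: u E.A.inv_closed E.f_closed E.direction_closed)
qed

lemma n_closed: "a \<in> carrier A \<Longrightarrow> n a \<in> carrier P"
  by simp

lemma N_subgroup: "subgroup N P" and N_circ_subgroup: "subgroup N (circ_group P)"
proof -
  have "group (triv_brace A)" "group (circ_group (triv_brace A))"
    using E.triv by (simp_all add: left_skew_brace_def left_skew_brace_axioms_def)
  then have "group_hom (triv_brace A) P n" "group_hom (circ_group (triv_brace A)) (circ_group P) n"
    using n_hom P.is_group P.circ_group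
    by (simp_all add: group_hom_def group_hom_axioms_def brace_hom_def)
  from this[THEN group_hom.img_is_subgroup]
  show "subgroup N P" "subgroup N (circ_group P)" by (simp_all add: N_eq)
qed

lemma N_normal: "N \<lhd> P"
proof -
  have "u \<otimes>\<^bsub>P\<^esub> h \<otimes>\<^bsub>P\<^esub> inv\<^bsub>P\<^esub> u \<in> N" if u: "u \<in> carrier P" and h: "h \<in> N" for u h
  proof -
    obtain a where a: "a \<in> carrier A" "h = n a" using h unfolding N_eq by (rule imageE)
    obtain b where b: "b \<in> carrier A" "u \<otimes>\<^bsub>P\<^esub> n a = n b \<otimes>\<^bsub>P\<^esub> u" using n_conj[OF u a(1)] .
    have "u \<otimes>\<^bsub>P\<^esub> h \<otimes>\<^bsub>P\<^esub> inv\<^bsub>P\<^esub> u = n b \<otimes>\<^bsub>P\<^esub> (u \<otimes>\<^bsub>P\<^esub> inv\<^bsub>P\<^esub> u)"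
      unfolding a(2) b(2) using u n_closed[OF b(1)] by (intro P.m_assoc) simp_all
    also have "\<dots> = n b" using u n_closed[OF b(1)] by (simp only: P.r_inv P.r_one)
    finally show ?thesis using b(1) by (simp add: N_eq)
  qed
  then show ?thesis using N_subgroup by (simp add: P.normal_inv_iff)
qed

lemma N_circ_normal: "N \<lhd> circ_group P"
proof -
  have "u \<bullet>\<^bsub>P\<^esub> h \<bullet>\<^bsub>P\<^esub> P.cinv u \<in> N" if u: "u \<in> carrier P" and h: "h \<in> N" for u h
  proof -
    obtain a where a: "a \<in> carrier A" "h = n a" using h unfolding N_eq by (rule imageE)
    obtain b where b: "b \<in> carrier A" "u \<bullet>\<^bsub>P\<^esub> n a = n b \<bullet>\<^bsub>P\<^esub> u" using n_circ_conj[OF u a(1)] .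
    have "u \<bullet>\<^bsub>P\<^esub> h \<bullet>\<^bsub>P\<^esub> P.cinv u = n b \<bullet>\<^bsub>P\<^esub> (u \<bullet>\<^bsub>P\<^esub> P.cinv u)"
      unfolding a(2) b(2) using u n_closed[OF b(1)] by (intro P.cmult_assoc) simp_all
    also have "\<dots> = n b" using u n_closed[OF b(1)] by (simp only: P.cinv_simps P.cmult_one)
    finally show ?thesis using b(1) by (simp add: N_eq)
  qed
  then show ?thesis
    using N_circ_subgroup by (simp add: group.normal_inv_iff[OF P.circ_group])
qed

text \<open>Rewriting \<open>u \<bullet> n a\<close> as \<open>n b \<bullet> u\<close> and then as
  \<open>n c \<otimes> u\<close> shows the lambda image to be a conjugate of \<open>n c\<close> for
  the first law, and normality applies. All three components of the direction enter.\<close>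

lemma N_lambda:
  assumes u: "u \<in> carrier P" and h: "h \<in> N"
  shows "brace_lambda P u h \<in> N"
proof -
  obtain a where a: "a \<in> carrier A" "h = n a" using h unfolding N_eq by (rule imageE)
  obtain b where b: "b \<in> carrier A" "u \<bullet>\<^bsub>P\<^esub> n a = n b \<bullet>\<^bsub>P\<^esub> u" using n_circ_conj[OF u a(1)] .
  obtain c where c: "c \<in> carrier A" "n b \<bullet>\<^bsub>P\<^esub> u = n c \<otimes>\<^bsub>P\<^esub> u" using n_cmult_eq_mult[OF u b(1)] .
  \<comment> \<open>The double inverse presents this as conjugation by the inverse of
    \<open>u\<close>, the form of the normality criterion.\<close>
  have "brace_lambda P u h = inv\<^bsub>P\<^esub> u \<otimes>\<^bsub>P\<^esub> n c \<otimes>\<^bsub>P\<^esub> inv\<^bsub>P\<^esub> (inv\<^bsub>P\<^esub> u)"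
    unfolding brace_lambda_def a(2) b(2) c(2) using u n_closed[OF c(1)]
    by (simp only: P.m_assoc P.inv_inv P.inv_closed)
  moreover have "n c \<in> N" using c(1) by (simp add: N_eq)
  moreover have "\<forall>u\<in>carrier P. \<forall>h\<in>N. u \<otimes>\<^bsub>P\<^esub> h \<otimes>\<^bsub>P\<^esub> inv\<^bsub>P\<^esub> u \<in> N"
    using N_normal unfolding P.normal_inv_iff by (rule conjunct2)
  ultimately show ?thesis using P.inv_closed[OF u] by (simp only:)
qed

lemma antidiagonal_ideal: "brace_ideal N P"
  unfolding brace_ideal_def
proof (intro conjI ballI)
  show "N #>\<^bsub>P\<^esub> u = u <#\<^bsub>P\<^esub> N" if "u \<in> carrier P" for u
    using normal.coset_eq[OF N_normal] that by (rule bspec)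
qed (simp_all add: P.left_skew_brace_axioms N_subgroup N_circ_subgroup N_circ_normal
    image_subset_iff N_lambda)

sublocale P: brace_with_ideal P N
  by unfold_locales (rule antidiagonal_ideal)

abbreviation \<theta> where "\<theta> \<equiv> baer_quotient_map A E F"

lemma middle_baer_sum: "middle (baer_sum A E F) = brace_quotient P N"
  by (simp add: baer_sum_def)

lemma theta_hom: "\<theta> \<in> brace_hom P (middle (baer_sum A E F))"
  unfolding middle_baer_sum baer_quotient_map_def by (rule P.quotient_map_hom)

lemma theta_surj: "\<theta> ` carrier P = carrier (middle (baer_sum A E F))"
  unfolding middle_baer_sum baer_quotient_map_def by (rule P.quotient_map_surj)

lemma theta_eqD:
  assumes "\<theta> (x, x') = \<theta> (z, z')" "(x, x') \<in> carrier P" "(z, z') \<in> carrier P"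
  obtains a where "a \<in> carrier A"
    "x = E.k (inv\<^bsub>A\<^esub> a) \<otimes>\<^bsub>E.X\<^esub> z" "x' = F.k a \<otimes>\<^bsub>F.X\<^esub> z'"
proof -
  from assms obtain h where "h \<in> N" "(x, x') = h \<otimes>\<^bsub>P\<^esub> (z, z')"
    unfolding baer_quotient_map_def using P.quotient_map_eq_iff by metis
  then show thesis unfolding N_eq using that by force
qed

lemma theta_eqI:
  assumes "a \<in> carrier A" "(z, z') \<in> carrier P"
  shows "\<theta> (E.k (inv\<^bsub>A\<^esub> a) \<otimes>\<^bsub>E.X\<^esub> z, F.k a \<otimes>\<^bsub>F.X\<^esub> z') = \<theta> (z, z')"
proof -
  have "n a \<in> N" "n a \<otimes>\<^bsub>P\<^esub> (z, z') \<in> carrier P" using assms by (simp_all add: N_eq)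
  then have "\<theta> (n a \<otimes>\<^bsub>P\<^esub> (z, z')) = \<theta> (z, z')"
    unfolding baer_quotient_map_def using P.quotient_map_eq_iff assms by metis
  then show ?thesis by simp
qed

text \<open>Antidiagonal pairs lie over the unit, so \<open>E.f\<close> is constant on the coset and
  \<open>the_elem\<close> is applied to a singleton.\<close>

lemma quo_map_theta:
  assumes "(x, x') \<in> carrier P"
  shows "quo_map (baer_sum A E F) (\<theta> (x, x')) = E.f x"
proof -
  have "N #>\<^bsub>P\<^esub> (x, x') = (\<lambda>a. n a \<otimes>\<^bsub>P\<^esub> (x, x')) ` carrier A"
    unfolding r_coset_def N_eq by blast
  then have "(\<lambda>(x, x'). E.f x) ` (N #>\<^bsub>P\<^esub> (x, x')) = (\<lambda>a. E.f x) ` carrier A"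
    using assms by (simp only: image_image) (rule image_cong, simp_all)
  also have "\<dots> = {E.f x}" using E.A.one_closed by (simp only: image_constant)
  finally have "(\<lambda>(x, x'). E.f x) ` (N #>\<^bsub>P\<^esub> (x, x')) = {E.f x}" .
  then show ?thesis by (simp add: baer_sum_def baer_quotient_map_def quotient_map_def)
qed

lemma ker_map_baer_sum: "ker_map (baer_sum A E F) a = \<theta> (\<one>\<^bsub>E.X\<^esub>, F.k a)"
  by (simp add: baer_sum_def)

text \<open>On the kernels \<open>\<theta>\<close> is addition: the antidiagonal pair with parameter
  the inverse of \<open>a\<close> moves the first entry of \<open>(E.k a, F.k b)\<close> into the
  second.\<close>

lemma theta_k:
  assumes "a \<in> carrier A" "b \<in> carrier A"
  shows "\<theta> (E.k a, F.k b) = ker_map (baer_sum A E F) (a \<otimes>\<^bsub>A\<^esub> b)"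
proof -
  have "inv\<^bsub>A\<^esub> a \<otimes>\<^bsub>A\<^esub> (a \<otimes>\<^bsub>A\<^esub> b) = b" using assms by (simp add: E.A.m_assoc[symmetric])
  then show ?thesis
    using theta_eqI[of "inv\<^bsub>A\<^esub> a" "\<one>\<^bsub>E.X\<^esub>" "F.k (a \<otimes>\<^bsub>A\<^esub> b)"] assms
    by (simp add: ker_map_baer_sum F.k_mult[symmetric])
qed

lemma snd_k_hom: "(\<lambda>a. (\<one>\<^bsub>E.X\<^esub>, F.k a)) \<in> brace_hom (triv_brace A) P"
  by (rule brace_homI) (simp_all add: F.k_mult F.k_cmult[symmetric])

lemma f_fst_hom: "(\<lambda>u. E.f (fst u)) \<in> brace_hom P Y"
  by (rule brace_homI) auto

lemma f_fst_surj: "(\<lambda>u. E.f (fst u)) ` carrier P = carrier Y"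
proof (intro subset_antisym subsetI)
  fix y assume y: "y \<in> carrier Y"
  obtain x where "x \<in> carrier E.X" "E.f x = y" using y by (rule E.fibre_nonempty)
  moreover obtain x' where "x' \<in> carrier F.X" "F.f x' = y" using y by (rule F.fibre_nonempty)
  ultimately show "y \<in> (\<lambda>u. E.f (fst u)) ` carrier P" by (intro image_eqI[of _ _ "(x, x')"]) auto
qed auto

lemma snd_k_direction:
  assumes "u \<in> carrier P" "a \<in> carrier A"
  shows "u \<otimes>\<^bsub>P\<^esub> (\<one>\<^bsub>E.X\<^esub>, F.k a) = (\<one>\<^bsub>E.X\<^esub>, F.k (\<phi>s (E.f (fst u)) a)) \<otimes>\<^bsub>P\<^esub> u \<and>
    u \<bullet>\<^bsub>P\<^esub> (\<one>\<^bsub>E.X\<^esub>, F.k a) = (\<one>\<^bsub>E.X\<^esub>, F.k (\<phi>c (E.f (fst u)) a)) \<bullet>\<^bsub>P\<^esub> u \<and>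
    (\<one>\<^bsub>E.X\<^esub>, F.k a) \<bullet>\<^bsub>P\<^esub> u = (\<one>\<^bsub>E.X\<^esub>, F.k (\<xi> (E.f (fst u)) a)) \<otimes>\<^bsub>P\<^esub> u"
proof -
  obtain x x' where [simp]: "u = (x, x')" by fastforce
  have [simp]: "x \<in> carrier E.X" "x' \<in> carrier F.X" "E.f x = F.f x'" using assms(1) by simp_all
  show ?thesis using assms(2) F.mult_k[of x' a] F.cmult_k[of x' a] F.k_cmult_eq_mult[of x' a] by simp
qed

text \<open>In the fibre product the map \<open>a \<mapsto> (1, F.k a)\<close> already has the right
  direction, but its image is only one factor of the kernel \<open>A \<times> A\<close>. The
  quotient merges the other factor into it, by \<open>theta_k\<close>.\<close>

lemma baer_sum_ext: "baer_sum A E F \<in> brace_exts A Y \<phi>s \<phi>c \<xi>"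
proof (rule brace_exts_surjI[OF E.triv P.left_skew_brace_axioms E.Y.left_skew_brace_axioms
      snd_k_hom f_fst_hom f_fst_surj _ snd_k_direction theta_hom theta_surj])
  show "\<theta> \<one>\<^bsub>P\<^esub> = \<one>\<^bsub>middle (baer_sum A E F)\<^esub>"
    unfolding middle_baer_sum baer_quotient_map_def by (rule P.quotient_map_one)
next
  fix a b assume ab: "a \<in> carrier A" "b \<in> carrier A"
    and eq: "\<theta> (\<one>\<^bsub>E.X\<^esub>, F.k a) = \<theta> (\<one>\<^bsub>E.X\<^esub>, F.k b)"
  from eq obtain c where c: "c \<in> carrier A" "\<one>\<^bsub>E.X\<^esub> = E.k (inv\<^bsub>A\<^esub> c) \<otimes>\<^bsub>E.X\<^esub> \<one>\<^bsub>E.X\<^esub>"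
      "F.k a = F.k c \<otimes>\<^bsub>F.X\<^esub> F.k b"
    by (rule theta_eqD) (use ab in simp_all)
  \<comment> \<open>The antidiagonal meets the second kernel factor only in the unit: a trivial
    first coordinate forces \<open>c\<close> to be trivial.\<close>
  from c(1,2) have "E.k \<one>\<^bsub>A\<^esub> = E.k (inv\<^bsub>A\<^esub> c)" by simp
  then have "c = \<one>\<^bsub>A\<^esub>" using c(1) E.A.inv_eq_1_iff[of c] by (simp del: E.k_one)
  then show "a = b" using c(3) ab by simp
next
  fix u assume u: "u \<in> carrier P"
  obtain x x' where [simp]: "u = (x, x')" by fastforce
  have x [simp]: "x \<in> carrier E.X" "x' \<in> carrier F.X" "E.f x = F.f x'" using u by simp_all
  show "E.f (fst u) = \<one>\<^bsub>Y\<^esub> \<longleftrightarrow> (\<exists>a\<in>carrier A. \<theta> u = \<theta> (\<one>\<^bsub>E.X\<^esub>, F.k a))"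
  proof
    \<comment> \<open>Over the unit both coordinates come from \<open>A\<close>, and
      \<open>theta_k\<close> combines them into one.\<close>
    assume "E.f (fst u) = \<one>\<^bsub>Y\<^esub>"
    then have "x \<in> E.k ` carrier A" "x' \<in> F.k ` carrier A"
      unfolding E.k_image F.k_image using x by simp_all
    then obtain a b where "a \<in> carrier A" "x = E.k a" "b \<in> carrier A" "x' = F.k b"
      by (elim imageE)
    then show "\<exists>a\<in>carrier A. \<theta> u = \<theta> (\<one>\<^bsub>E.X\<^esub>, F.k a)"
      using theta_k[of a b] by (intro bexI[of _ "a \<otimes>\<^bsub>A\<^esub> b"]) (simp_all add: ker_map_baer_sum)
  next
    assume "\<exists>a\<in>carrier A. \<theta> u = \<theta> (\<one>\<^bsub>E.X\<^esub>, F.k a)"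
    then obtain a where a: "a \<in> carrier A" "\<theta> (x, x') = \<theta> (\<one>\<^bsub>E.X\<^esub>, F.k a)" by auto
    from a(2) obtain c where "c \<in> carrier A" "x = E.k (inv\<^bsub>A\<^esub> c) \<otimes>\<^bsub>E.X\<^esub> \<one>\<^bsub>E.X\<^esub>"
      by (rule theta_eqD) (use a(1) u in simp_all)
    then show "E.f (fst u) = \<one>\<^bsub>Y\<^esub>" by (simp del: x(3))
  qed
qed (auto simp: ker_map_baer_sum quo_map_theta)

sublocale S: brace_ext A Y \<phi>s \<phi>c \<xi> "baer_sum A E F"
  by unfold_locales (rule baer_sum_ext)

end

section \<open>Isomorphisms and biadditive maps\<close>

context ext_pair
begin

text \<open>The short five lemma.\<close>

lemma seq_isoI:
  assumes h: "h \<in> brace_hom E.X F.X"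
    and hk: "\<And>a. a \<in> carrier A \<Longrightarrow> h (E.k a) = F.k a"
    and fh: "\<And>x. x \<in> carrier E.X \<Longrightarrow> F.f (h x) = E.f x"
  shows "seq_iso A E F"
proof -
  note [simp] = brace_homD[OF h] hk fh
  have "inj_on h (carrier E.X)"
  proof (rule inj_onI)
    fix x z assume x: "x \<in> carrier E.X" and z: "z \<in> carrier E.X" and eq: "h x = h z"
    have "E.f x = E.f z" using fh[OF x] fh[OF z] eq by simp
    then obtain a where a: "a \<in> carrier A" "x = E.k a \<otimes>\<^bsub>E.X\<^esub> z" using E.fibre_mult[OF x z] by blast
    then have "F.k a \<otimes>\<^bsub>F.X\<^esub> h z = h z" using eq z by simp
    then have "F.k a = F.k \<one>\<^bsub>A\<^esub>" using a z by simp
    then have "a = \<one>\<^bsub>A\<^esub>" using a(1) by (simp del: F.k_one)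
    then show "x = z" using a z by simp
  qed
  moreover have "x' \<in> h ` carrier E.X" if x': "x' \<in> carrier F.X" for x'
  proof -
    obtain x where x: "x \<in> carrier E.X" "E.f x = F.f x'"
      using E.fibre_nonempty[of "F.f x'"] x' by auto
    \<comment> \<open>A point \<open>x\<close> with the right image in \<open>Y\<close> is corrected
      by an element of the kernel, where \<open>h\<close> is known.\<close>
    obtain a where "a \<in> carrier A" "x' = F.k a \<otimes>\<^bsub>F.X\<^esub> h x"
      by (rule F.fibre_mult[OF x', of "h x"]) (use x in simp_all)
    then have "x' = h (E.k a \<otimes>\<^bsub>E.X\<^esub> x)" "E.k a \<otimes>\<^bsub>E.X\<^esub> x \<in> carrier E.X" using x by simp_all
    then show ?thesis by (rule image_eqI)
  qed
  ultimately have "bij_betw h (carrier E.X) (carrier F.X)" by (auto simp: bij_betw_def)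
  then show ?thesis unfolding seq_iso_def using h hk fh by blast
qed

text \<open>The inverse is obtained as the factorisation of the identity through the bijection
  \<open>h\<close>, which yields the homomorphism property for both laws at once.\<close>

lemma seq_iso_sym:
  assumes "seq_iso A E F"
  shows "seq_iso A F E"
proof -
  interpret FE: ext_pair A Y \<phi>s \<phi>c \<xi> F E ..
  obtain h where h: "h \<in> brace_hom E.X F.X" "bij_betw h (carrier E.X) (carrier F.X)"
    and hk: "\<And>a. a \<in> carrier A \<Longrightarrow> h (E.k a) = F.k a"
    and fh: "\<And>x. x \<in> carrier E.X \<Longrightarrow> F.f (h x) = E.f x"
    using assms unfolding seq_iso_def by blast
  have surj: "h ` carrier E.X = carrier F.X" and inj: "inj_on h (carrier E.X)"
    using h(2) by (simp_all add: bij_betw_def)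
  have "id \<in> brace_hom E.X E.X" by (rule brace_homI) simp_all
  then obtain g where g: "g \<in> brace_hom F.X E.X" and gh: "\<And>x. x \<in> carrier E.X \<Longrightarrow> g (h x) = id x"
    using brace_hom_factor[OF E.X.left_skew_brace_axioms h(1) _ surj, of id E.X] inj
    by (metis id_apply inj_onD)
  show ?thesis
  proof (rule FE.seq_isoI[OF g])
    show "g (F.k a) = E.k a" if "a \<in> carrier A" for a
      using gh[of "E.k a"] hk[OF that] that by simp
    fix x' assume "x' \<in> carrier F.X"
    then obtain x where "x \<in> carrier E.X" "x' = h x" unfolding surj[symmetric] by (rule imageE)
    then show "E.f (g x') = F.f x'" using fh gh by simp
  qed
qed

end

lemma seq_iso_trans:
  assumes "seq_iso A E F" "seq_iso A F G"
  shows "seq_iso A E G"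
proof -
  obtain h where h: "h \<in> brace_hom (middle E) (middle F)"
    "bij_betw h (carrier (middle E)) (carrier (middle F))"
    "\<forall>a\<in>carrier A. h (ker_map E a) = ker_map F a"
    "\<forall>x\<in>carrier (middle E). quo_map F (h x) = quo_map E x"
    using assms(1) unfolding seq_iso_def by blast
  obtain g where g: "g \<in> brace_hom (middle F) (middle G)"
    "bij_betw g (carrier (middle F)) (carrier (middle G))"
    "\<forall>a\<in>carrier A. g (ker_map F a) = ker_map G a"
    "\<forall>x\<in>carrier (middle F). quo_map G (g x) = quo_map F x"
    using assms(2) unfolding seq_iso_def by blast
  show ?thesis unfolding seq_iso_def
  proof (intro exI[of _ "g \<circ> h"] conjI)
    show "g \<circ> h \<in> brace_hom (middle E) (middle G)" using h(1) g(1) by (rule brace_hom_compose)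
    show "bij_betw (g \<circ> h) (carrier (middle E)) (carrier (middle G))"
      using h(2) g(2) by (rule bij_betw_trans)
  qed (use h(3,4) g(3,4) brace_homD(1)[OF h(1)] in simp_all)
qed

text \<open>Such a map exhibits \<open>G\<close> as a Baer sum of \<open>E\<close> and \<open>F\<close>, see \<open>baer_map_iso\<close>.\<close>

definition baer_map ::
  "'a monoid \<Rightarrow> ('a, 'x, 'y) brace_seq \<Rightarrow> ('a, 'z, 'y) brace_seq \<Rightarrow> ('a, 'v, 'y) brace_seq \<Rightarrow>
   ('x \<times> 'z \<Rightarrow> 'v) \<Rightarrow> bool" where
  "baer_map A E F G q \<longleftrightarrow>
     q \<in> brace_hom (fibre_product E F) (middle G) \<and>
     (\<forall>a\<in>carrier A. \<forall>b\<in>carrier A. q (ker_map E a, ker_map F b) = ker_map G (a \<otimes>\<^bsub>A\<^esub> b)) \<and>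
     (\<forall>x x'. (x, x') \<in> carrier (fibre_product E F) \<longrightarrow> quo_map G (q (x, x')) = quo_map E x)"

context ext_pair
begin

text \<open>On an antidiagonal pair \<open>q\<close> takes the value \<open>G.k\<close> of an
  inverse times its element, the unit, so \<open>q\<close> is constant on cosets. The factor
  respects kernel and quotient maps, and bijectivity is then automatic by
  \<open>seq_isoI\<close>.\<close>

lemma baer_map_iso:
  assumes G: "brace_ext A Y \<phi>s \<phi>c \<xi> G" and q: "baer_map A E F G q"
  shows "seq_iso A (baer_sum A E F) G"
proof -
  interpret G: brace_ext A Y \<phi>s \<phi>c \<xi> G by fact
  interpret SG: ext_pair A Y \<phi>s \<phi>c \<xi> "baer_sum A E F" G ..
  have q_hom: "q \<in> brace_hom P G.X"
    and qk: "\<And>a b. \<lbrakk>a \<in> carrier A; b \<in> carrier A\<rbrakk> \<Longrightarrow> q (E.k a, F.k b) = G.k (a \<otimes>\<^bsub>A\<^esub> b)"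
    and fq: "\<And>x x'. (x, x') \<in> carrier P \<Longrightarrow> G.f (q (x, x')) = E.f x"
    using q unfolding baer_map_def by blast+
  have fibres: "q u = q v" if u: "u \<in> carrier P" and v: "v \<in> carrier P" and eq: "\<theta> u = \<theta> v" for u v
  proof -
    obtain x x' where ux: "u = (x, x')" by fastforce
    obtain z z' where vz: "v = (z, z')" by fastforce
    obtain a where a: "a \<in> carrier A" "x = E.k (inv\<^bsub>A\<^esub> a) \<otimes>\<^bsub>E.X\<^esub> z" "x' = F.k a \<otimes>\<^bsub>F.X\<^esub> z'"
      using theta_eqD eq u v unfolding ux vz by metis
    have "u = n a \<otimes>\<^bsub>P\<^esub> v" unfolding ux vz a(2,3) by simp
    then have "q u = q (n a) \<otimes>\<^bsub>G.X\<^esub> q v"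
      using brace_homD(2)[OF q_hom n_closed[OF a(1)] v] by simp
    then show ?thesis using qk[of "inv\<^bsub>A\<^esub> a" a] a(1) brace_homD(1)[OF q_hom v] by simp
  qed
  obtain h where h: "h \<in> brace_hom (middle (baer_sum A E F)) G.X"
    and eq: "\<And>u. u \<in> carrier P \<Longrightarrow> h (\<theta> u) = q u"
    using brace_hom_factor[OF P.left_skew_brace_axioms theta_hom q_hom theta_surj fibres] by blast
  show ?thesis
  proof (rule SG.seq_isoI[OF h])
    show "h (S.k a) = G.k a" if a: "a \<in> carrier A" for a
      using a eq[of "(\<one>\<^bsub>E.X\<^esub>, F.k a)"] qk[of "\<one>\<^bsub>A\<^esub>" a] by (simp add: ker_map_baer_sum)
    fix c assume "c \<in> carrier S.X"
    then obtain u where "u \<in> carrier P" "c = \<theta> u" unfolding theta_surj[symmetric] by (rule imageE)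
    then show "G.f (h c) = S.f c" by (cases u) (simp add: eq fq quo_map_theta del: fibre_product_simps)
  qed
qed

end

section \<open>Invariance, commutativity and associativity of the Baer sum\<close>

lemma baer_sum_cong:
  assumes "ext_pair A Y \<phi>s \<phi>c \<xi> E F" "ext_pair A Y \<phi>s \<phi>c \<xi> E' F'"
    and "seq_iso A E E'" "seq_iso A F F'"
  shows "seq_iso A (baer_sum A E F) (baer_sum A E' F')"
proof -
  interpret S: ext_pair A Y \<phi>s \<phi>c \<xi> E F by fact
  interpret S': ext_pair A Y \<phi>s \<phi>c \<xi> E' F' by fact
  obtain h where h: "h \<in> brace_hom (middle E) (middle E')"
    "\<forall>a\<in>carrier A. h (ker_map E a) = ker_map E' a"
    "\<forall>x\<in>carrier (middle E). quo_map E' (h x) = quo_map E x"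
    using assms(3) unfolding seq_iso_def by blast
  obtain g where g: "g \<in> brace_hom (middle F) (middle F')"
    "\<forall>a\<in>carrier A. g (ker_map F a) = ker_map F' a"
    "\<forall>x\<in>carrier (middle F). quo_map F' (g x) = quo_map F x"
    using assms(4) unfolding seq_iso_def by blast
  note [simp] = brace_homD[OF h(1)] brace_homD[OF g(1)] h(2,3)[rule_format] g(2,3)[rule_format]
  have hom: "map_prod h g \<in> brace_hom S.P S'.P"
    by (rule brace_homI) auto
  \<comment> \<open>The product of the two isomorphisms fixes kernel coordinates, so following it by
    the second quotient map still gives addition on \<open>A \<times> A\<close>.\<close>
  have "baer_map A E F (baer_sum A E' F') (S'.\<theta> \<circ> map_prod h g)"
    unfolding baer_map_def
    using brace_hom_compose[OF hom S'.theta_hom] by (simp add: S'.theta_k S'.quo_map_theta)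
  then show ?thesis by (rule S.baer_map_iso[OF S'.S.brace_ext_axioms])
qed

text \<open>The coordinate swap exchanges the summands, and commutativity of \<open>A\<close>
  restores their order on the kernels.\<close>

lemma baer_sum_comm:
  assumes "ext_pair A Y \<phi>s \<phi>c \<xi> E F"
  shows "seq_iso A (baer_sum A E F) (baer_sum A F E)"
proof -
  interpret EF: ext_pair A Y \<phi>s \<phi>c \<xi> E F by fact
  interpret FE: ext_pair A Y \<phi>s \<phi>c \<xi> F E ..
  have hom: "prod.swap \<in> brace_hom EF.P FE.P"
    by (rule brace_homI) auto
  have "baer_map A E F (baer_sum A F E) (FE.\<theta> \<circ> prod.swap)"
    unfolding baer_map_def using brace_hom_compose[OF hom FE.theta_hom]
    by (simp add: FE.theta_k FE.quo_map_theta EF.E.A.m_comm)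
  then show ?thesis by (rule EF.baer_map_iso[OF FE.S.brace_ext_axioms])
qed

text \<open>The domain \<open>L.P\<close> is a quotient of the triple fibre product:
  \<open>p\<close> divides out the antidiagonal of \<open>E\<close> and \<open>F\<close>, while
  \<open>q\<close> takes a triple to the other iterated sum. Constancy of \<open>q\<close> on the
  fibres of \<open>p\<close> lets it descend to the required map on \<open>L.P\<close>.\<close>

lemma baer_sum_assoc:
  fixes E :: "('a, 'x, 'y) brace_seq" and F :: "('a, 'z, 'y) brace_seq"
    and G :: "('a, 'v, 'y) brace_seq"
  assumes "brace_ext A Y \<phi>s \<phi>c \<xi> E" "brace_ext A Y \<phi>s \<phi>c \<xi> F" "brace_ext A Y \<phi>s \<phi>c \<xi> G"
  shows "seq_iso A (baer_sum A (baer_sum A E F) G) (baer_sum A E (baer_sum A F G))"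
proof -
  interpret E: brace_ext A Y \<phi>s \<phi>c \<xi> E by fact
  interpret F: brace_ext A Y \<phi>s \<phi>c \<xi> F by fact
  interpret G: brace_ext A Y \<phi>s \<phi>c \<xi> G by fact
  interpret EF: ext_pair A Y \<phi>s \<phi>c \<xi> E F ..
  interpret FG: ext_pair A Y \<phi>s \<phi>c \<xi> F G ..
  interpret L: ext_pair A Y \<phi>s \<phi>c \<xi> "baer_sum A E F" G ..
  interpret R: ext_pair A Y \<phi>s \<phi>c \<xi> E "baer_sum A F G" ..
  \<comment> \<open>The triple fibre product is a fibre product over \<open>Y\<close>; the kernel map of \<open>D\<close> plays no role.\<close>
  define D where
    "D = \<lparr>middle = EF.P, ker_map = (\<lambda>a. EF.n a), quo_map = (\<lambda>u. E.f (fst u))\<rparr>"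
  have D [simp]: "middle D = EF.P" "quo_map D (x, x') = E.f x" for x x' by (simp_all add: D_def)
  let ?T = "fibre_product D G"
  have T: "left_skew_brace ?T"
    by (rule fibre_product_left_skew_brace[OF _ G.X.left_skew_brace_axioms
          E.Y.left_skew_brace_axioms _ G.f_hom])
      (use EF.P.left_skew_brace_axioms EF.f_fst_hom in \<open>simp_all add: D_def\<close>)
  define p :: "('x \<times> 'z) \<times> 'v \<Rightarrow> ('x \<times> 'z) set \<times> 'v"
    where "p = (\<lambda>((x, x'), x''). (EF.\<theta> (x, x'), x''))"
  define q :: "('x \<times> 'z) \<times> 'v \<Rightarrow> ('x \<times> ('z \<times> 'v) set) set"
    where "q = (\<lambda>((x, x'), x''). R.\<theta> (x, FG.\<theta> (x', x'')))"
  note \<theta>_simps = brace_homD[OF EF.theta_hom] brace_homD[OF FG.theta_hom] brace_homD[OF R.theta_hom]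
  have triple: "(x, x') \<in> carrier EF.P" "(x', x'') \<in> carrier FG.P"
    "(EF.\<theta> (x, x'), x'') \<in> carrier L.P" "(x, FG.\<theta> (x', x'')) \<in> carrier R.P"
    if "((x, x'), x'') \<in> carrier ?T" for x x' x''
  proof -
    show xx: "(x, x') \<in> carrier EF.P" and xx': "(x', x'') \<in> carrier FG.P" using that by auto
    show "(EF.\<theta> (x, x'), x'') \<in> carrier L.P"
      using that brace_homD(1)[OF EF.theta_hom xx] EF.quo_map_theta[OF xx] by auto
    show "(x, FG.\<theta> (x', x'')) \<in> carrier R.P"
      using that brace_homD(1)[OF FG.theta_hom xx'] FG.quo_map_theta[OF xx'] by auto
  qed
  have p_closed: "p u \<in> carrier L.P" and q_closed: "q u \<in> carrier R.S.X" if "u \<in> carrier ?T" for u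
  proof -
    obtain x x' x'' where u: "u = ((x, x'), x'')" by (metis prod.exhaust)
    show "p u \<in> carrier L.P" using triple(3) that unfolding u p_def prod.case .
    show "q u \<in> carrier R.S.X" using brace_homD(1)[OF R.theta_hom triple(4)] that
      unfolding u q_def prod.case .
  qed
  have p_hom: "p \<in> brace_hom ?T L.P"
  proof (rule brace_homI)
    fix u v assume u: "u \<in> carrier ?T" and v: "v \<in> carrier ?T"
    obtain x x' x'' where [simp]: "u = ((x, x'), x'')" by (metis prod.exhaust)
    obtain z z' z'' where [simp]: "v = ((z, z'), z'')" by (metis prod.exhaust)
    show "p (u \<otimes>\<^bsub>?T\<^esub> v) = p u \<otimes>\<^bsub>L.P\<^esub> p v"
      using u v \<theta>_simps(2)[of "(x, x')" "(z, z')"] by (simp add: p_def)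
    show "p (u \<bullet>\<^bsub>?T\<^esub> v) = p u \<bullet>\<^bsub>L.P\<^esub> p v"
      using u v \<theta>_simps(3)[of "(x, x')" "(z, z')"] by (simp add: p_def)
  qed (rule p_closed)
  have q_hom: "q \<in> brace_hom ?T R.S.X"
  proof (rule brace_homI)
    fix u v assume u: "u \<in> carrier ?T" and v: "v \<in> carrier ?T"
    obtain x x' x'' where ux [simp]: "u = ((x, x'), x'')" by (metis prod.exhaust)
    obtain z z' z'' where vz [simp]: "v = ((z, z'), z'')" by (metis prod.exhaust)
    have cl: "(x, FG.\<theta> (x', x'')) \<in> carrier R.P" "(z, FG.\<theta> (z', z'')) \<in> carrier R.P"
      using triple(4) u v unfolding ux vz by blast+
    show "q (u \<otimes>\<^bsub>?T\<^esub> v) = q u \<otimes>\<^bsub>R.S.X\<^esub> q v"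
      using \<theta>_simps(5)[OF triple(2)[OF u[unfolded ux]] triple(2)[OF v[unfolded vz]]] \<theta>_simps(8)[OF cl] by (simp add: q_def)
    show "q (u \<bullet>\<^bsub>?T\<^esub> v) = q u \<bullet>\<^bsub>R.S.X\<^esub> q v"
      using \<theta>_simps(6)[OF triple(2)[OF u[unfolded ux]] triple(2)[OF v[unfolded vz]]] \<theta>_simps(9)[OF cl] by (simp add: q_def)
  qed (rule q_closed)
  have p_surj: "p ` carrier ?T = carrier L.P"
  proof (intro subset_antisym subsetI)
    fix w assume w: "w \<in> carrier L.P"
    obtain c x'' where [simp]: "w = (c, x'')" by fastforce
    from w have "c \<in> EF.\<theta> ` carrier EF.P" unfolding EF.theta_surj by simp
    then obtain u where u: "u \<in> carrier EF.P" "c = EF.\<theta> u" by (rule imageE)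
    obtain x x' where [simp]: "u = (x, x')" by fastforce
    show "w \<in> p ` carrier ?T"
      by (rule image_eqI[of _ _ "((x, x'), x'')"])
        (use w u EF.quo_map_theta[of x x'] in \<open>simp_all add: p_def\<close>)
  qed (use p_closed in blast)
  have fibres: "q u = q v" if u: "u \<in> carrier ?T" and v: "v \<in> carrier ?T" and eq: "p u = p v" for u v
  proof -
    obtain x x' x'' where ux [simp]: "u = ((x, x'), x'')" by (metis prod.exhaust)
    obtain z z' z'' where vz [simp]: "v = ((z, z'), z'')" by (metis prod.exhaust)
    have eqs: "EF.\<theta> (x, x') = EF.\<theta> (z, z')" "x'' = z''" using eq by (simp_all add: p_def)
    obtain a where a: "a \<in> carrier A" "x = E.k (inv\<^bsub>A\<^esub> a) \<otimes>\<^bsub>E.X\<^esub> z" "x' = F.k a \<otimes>\<^bsub>F.X\<^esub> z'"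
      by (rule EF.theta_eqD[OF eqs(1)]) (use u v in simp_all)
    \<comment> \<open>The shift by \<open>F.k a\<close> leaves the inner quotient as a kernel
      element of the Baer sum of \<open>F\<close> and \<open>G\<close>; the outer antidiagonal then
      cancels it against the shift of \<open>z\<close>.\<close>
    have "FG.\<theta> (F.k a \<otimes>\<^bsub>F.X\<^esub> z', z'') = FG.S.k a \<otimes>\<^bsub>FG.S.X\<^esub> FG.\<theta> (z', z'')"
      using \<theta>_simps(5)[OF _ triple(2)[OF v[unfolded vz]], of "(F.k a, \<one>\<^bsub>G.X\<^esub>)"] v a(1) FG.theta_k[of a "\<one>\<^bsub>A\<^esub>"] by simp
    moreover have "(z, FG.\<theta> (z', z'')) \<in> carrier R.P"
      using triple(4) v unfolding vz .
    ultimately show ?thesis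
      using R.theta_eqI[OF a(1)] by (simp add: q_def a(2,3) eqs(2))
  qed
  obtain h where h: "h \<in> brace_hom L.P R.S.X" and hp: "\<And>u. u \<in> carrier ?T \<Longrightarrow> h (p u) = q u"
    using brace_hom_factor[OF T p_hom q_hom p_surj fibres] by blast
  have "baer_map A (baer_sum A E F) G (baer_sum A E (baer_sum A F G)) h"
    unfolding baer_map_def
  proof (intro conjI h ballI allI impI)
    fix a b assume ab: "a \<in> carrier A" "b \<in> carrier A"
    \<comment> \<open>The kernel map of a Baer sum is defined through its second factor, which
      dictates this lift along \<open>p\<close>.\<close>
    have "h (EF.S.k a, G.k b) = h (p ((\<one>\<^bsub>E.X\<^esub>, F.k a), G.k b))"
      by (simp add: p_def EF.ker_map_baer_sum)
    also have "\<dots> = q ((\<one>\<^bsub>E.X\<^esub>, F.k a), G.k b)" using ab by (intro hp) simp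
    also have "\<dots> = R.S.k (a \<otimes>\<^bsub>A\<^esub> b)"
      using ab by (simp add: q_def FG.theta_k R.ker_map_baer_sum)
    finally show "h (EF.S.k a, G.k b) = R.S.k (a \<otimes>\<^bsub>A\<^esub> b)" .
  next
    fix c x'' assume "(c, x'') \<in> carrier L.P"
    then obtain u where u: "u \<in> carrier ?T" "(c, x'') = p u" unfolding p_surj[symmetric] by (rule imageE)
    obtain x x' x3 where [simp]: "u = ((x, x'), x3)" by (metis prod.exhaust)
    have [simp]: "c = EF.\<theta> (x, x')" "x'' = x3" using u(2) by (simp_all add: p_def)
    have "(x, FG.\<theta> (x', x3)) \<in> carrier R.P" using triple(4) u(1) by simp
    from R.quo_map_theta[OF this] have "R.S.f (q u) = E.f x" by (simp add: q_def)
    then show "R.S.f (h (c, x'')) = EF.S.f c"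
      using hp[OF u(1)] u EF.quo_map_theta[of x x'] by simp
  qed
  then show ?thesis by (rule L.baer_map_iso[OF R.S.brace_ext_axioms])
qed

section \<open>The split sequence and inverses\<close>

context brace_ext
begin

text \<open>The difference of two points of a fibre, seen as a torsor under \<open>A\<close> for the
  first law. \<open>THE\<close> says nothing about points of different fibres; the computations stay
  within one.\<close>

definition coord where "coord x z = (THE a. a \<in> carrier A \<and> x = k a \<otimes>\<^bsub>X\<^esub> z)"

lemma coord_k_mult [simp]:
  assumes "a \<in> carrier A" "z \<in> carrier X"
  shows "coord (k a \<otimes>\<^bsub>X\<^esub> z) z = a"
  unfolding coord_def by (rule the_equality) (use assms in auto)

text \<open>The first point serves as base point, and only its image in \<open>Y\<close> is
  remembered. Shifting both points by the same kernel element changes nothing, so this is the fibre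
  square modulo the diagonal action of \<open>A\<close>.\<close>

definition split_map where "split_map = (\<lambda>(x, x'). (f x, coord x' x))"

lemma split_map_k_mult:
  assumes "a \<in> carrier A" "x \<in> carrier X"
  shows "split_map (x, k a \<otimes>\<^bsub>X\<^esub> x) = (f x, a)"
  using assms by (simp add: split_map_def)

lemma split_map_k:
  assumes "a \<in> carrier A"
  shows "split_map (\<one>\<^bsub>X\<^esub>, k a) = (\<one>\<^bsub>Y\<^esub>, a)"
  using split_map_k_mult[OF assms X.one_closed] assms by simp

abbreviation P2 where "P2 \<equiv> fibre_product E E"

lemma ext_pair_self: "ext_pair A Y \<phi>s \<phi>c \<xi> E E" ..

lemma fibre_square_cases:
  assumes "u \<in> carrier P2"
  obtains x a where "x \<in> carrier X" "a \<in> carrier A" "u = (x, k a \<otimes>\<^bsub>X\<^esub> x)"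
proof -
  obtain x x' where [simp]: "u = (x, x')" by fastforce
  have x: "x \<in> carrier X" "x' \<in> carrier X" "f x' = f x" using assms by simp_all
  obtain a where "a \<in> carrier A" "x' = k a \<otimes>\<^bsub>X\<^esub> x" using fibre_mult[OF x(2,1,3)] .
  then show thesis using that x(1) by simp
qed

lemma split_map_hom: "split_map \<in> brace_hom P2 (split_brace A Y \<phi>s \<phi>c \<xi>)"
proof (rule brace_homI)
  fix u v assume u: "u \<in> carrier P2" and v: "v \<in> carrier P2"
  obtain x a where xa: "x \<in> carrier X" "a \<in> carrier A" "u = (x, k a \<otimes>\<^bsub>X\<^esub> x)"
    using u by (rule fibre_square_cases)
  obtain z b where zb: "z \<in> carrier X" "b \<in> carrier A" "v = (z, k b \<otimes>\<^bsub>X\<^esub> z)"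
    using v by (rule fibre_square_cases)
  \<comment> \<open>The base point of the product is the product of the base points, so the new
    coordinate can be read off.\<close>
  have "u \<otimes>\<^bsub>P2\<^esub> v = (x \<otimes>\<^bsub>X\<^esub> z, k (a \<otimes>\<^bsub>A\<^esub> \<phi>s (f x) b) \<otimes>\<^bsub>X\<^esub> (x \<otimes>\<^bsub>X\<^esub> z))"
    unfolding xa(3) zb(3) fibre_product_simps mult_in_fibres[OF xa(1) zb(1) xa(2) zb(2)] ..
  then have "split_map (u \<otimes>\<^bsub>P2\<^esub> v) = (f (x \<otimes>\<^bsub>X\<^esub> z), a \<otimes>\<^bsub>A\<^esub> \<phi>s (f x) b)"
    using xa(1,2) zb(1,2) by (simp only: split_map_k_mult A.m_closed X.m_closed direction_closed f_closed)
  then show "split_map (u \<otimes>\<^bsub>P2\<^esub> v)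
      = split_map u \<otimes>\<^bsub>split_brace A Y \<phi>s \<phi>c \<xi>\<^esub> split_map v"
    using xa zb by (simp add: split_map_k_mult split_brace_def)
  have "u \<bullet>\<^bsub>P2\<^esub> v = (x \<bullet>\<^bsub>X\<^esub> z,
      k (\<xi> (f x \<bullet>\<^bsub>Y\<^esub> f z) (\<eta> (f x) a \<otimes>\<^bsub>A\<^esub> \<phi>c (f x) (\<eta> (f z) b))) \<otimes>\<^bsub>X\<^esub> (x \<bullet>\<^bsub>X\<^esub> z))"
    unfolding xa(3) zb(3) fibre_product_simps cmult_in_fibres[OF xa(1) zb(1) xa(2) zb(2)] ..
  then have "split_map (u \<bullet>\<^bsub>P2\<^esub> v) = (f (x \<bullet>\<^bsub>X\<^esub> z),
      \<xi> (f x \<bullet>\<^bsub>Y\<^esub> f z) (\<eta> (f x) a \<otimes>\<^bsub>A\<^esub> \<phi>c (f x) (\<eta> (f z) b)))"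
    using xa(1,2) zb(1,2)
    by (simp only: split_map_k_mult A.m_closed X.cmult_closed Y.cmult_closed direction_closed
        f_closed eta_closed)
  then show "split_map (u \<bullet>\<^bsub>P2\<^esub> v)
      = split_map u \<bullet>\<^bsub>split_brace A Y \<phi>s \<phi>c \<xi>\<^esub> split_map v"
    using xa zb by (simp add: split_map_k_mult split_brace_def)
  show "split_map u \<in> carrier (split_brace A Y \<phi>s \<phi>c \<xi>)"
    using xa by (simp add: split_map_k_mult split_brace_def)
qed

lemma split_map_surj: "split_map ` carrier P2 = carrier (split_brace A Y \<phi>s \<phi>c \<xi>)"
proof (intro subset_antisym subsetI)
  fix w assume "w \<in> carrier (split_brace A Y \<phi>s \<phi>c \<xi>)"
  then obtain y a where w: "w = (y, a)" and y: "y \<in> carrier Y" and a: "a \<in> carrier A"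
    by (auto simp: split_brace_def)
  obtain x where x: "x \<in> carrier X" "f x = y" using y by (rule fibre_nonempty)
  show "w \<in> split_map ` carrier P2"
    by (rule image_eqI[of _ _ "(x, k a \<otimes>\<^bsub>X\<^esub> x)"]) (use x y a w in \<open>simp_all add: split_map_k_mult\<close>)
qed (use brace_homD(1)[OF split_map_hom] in blast)

lemma split_seq_simps [simp]:
  "middle (split_seq A Y \<phi>s \<phi>c \<xi>) = split_brace A Y \<phi>s \<phi>c \<xi>"
  "ker_map (split_seq A Y \<phi>s \<phi>c \<xi>) a = (\<one>\<^bsub>Y\<^esub>, a)"
  "quo_map (split_seq A Y \<phi>s \<phi>c \<xi>) = fst"
  by (simp_all add: split_seq_def)

text \<open>The direction travels the same way as the axioms: it is known for
  \<open>a \<mapsto> (1, k a)\<close> in the fibre square, and \<open>split_map\<close> sends this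
  map to the split kernel map.\<close>

lemma split_seq_ext: "split_seq A Y \<phi>s \<phi>c \<xi> \<in> brace_exts A Y \<phi>s \<phi>c \<xi>"
proof -
  interpret EE: ext_pair A Y \<phi>s \<phi>c \<xi> E E by (rule ext_pair_self)
  show ?thesis
  proof (rule brace_exts_surjI[OF triv EE.P.left_skew_brace_axioms Y.left_skew_brace_axioms
        EE.snd_k_hom EE.f_fst_hom EE.f_fst_surj _ EE.snd_k_direction, where p = split_map])
    show "split_map \<in> brace_hom P2 (middle (split_seq A Y \<phi>s \<phi>c \<xi>))"
      "split_map ` carrier P2 = carrier (middle (split_seq A Y \<phi>s \<phi>c \<xi>))"
      by (simp_all add: split_map_hom split_map_surj)
    show "split_map \<one>\<^bsub>P2\<^esub> = \<one>\<^bsub>middle (split_seq A Y \<phi>s \<phi>c \<xi>)\<^esub>"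
      using split_map_k[OF A.one_closed] by (simp add: split_brace_def)
    fix u assume "u \<in> carrier P2"
    then obtain x a where xa: "x \<in> carrier X" "a \<in> carrier A" "u = (x, k a \<otimes>\<^bsub>X\<^esub> x)"
      by (rule fibre_square_cases)
    then show "quo_map (split_seq A Y \<phi>s \<phi>c \<xi>) (split_map u) = f (fst u)"
      by (simp add: split_map_k_mult)
    show "f (fst u) = \<one>\<^bsub>Y\<^esub> \<longleftrightarrow> (\<exists>b\<in>carrier A. split_map u = split_map (\<one>\<^bsub>X\<^esub>, k b))"
      using xa by (auto simp: split_map_k_mult split_map_k)
  qed (simp_all add: split_map_k)
qed

lemma split_seq_brace_ext: "brace_ext A Y \<phi>s \<phi>c \<xi> (split_seq A Y \<phi>s \<phi>c \<xi>)"
  by unfold_locales (rule split_seq_ext)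

text \<open>In the fibre product the entry in \<open>Y\<close> is determined by \<open>x\<close>.
  With base points \<open>x\<close> and \<open>z\<close>, \<open>mult_in_fibres\<close> and
  \<open>cmult_in_fibres\<close> are precisely the homomorphism properties of
  \<open>?q\<close>.\<close>

lemma split_seq_unit: "seq_iso A (baer_sum A (split_seq A Y \<phi>s \<phi>c \<xi>) E) E"
proof -
  interpret SE: ext_pair A Y \<phi>s \<phi>c \<xi> "split_seq A Y \<phi>s \<phi>c \<xi>" E
    by (rule ext_pair.intro[OF split_seq_brace_ext brace_ext_axioms])
  let ?q = "\<lambda>((y, a), x). k a \<otimes>\<^bsub>X\<^esub> x"
  have cases: "\<exists>a x. a \<in> carrier A \<and> x \<in> carrier X \<and> u = ((f x, a), x)" if "u \<in> carrier SE.P" for u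
    using that by (cases u) (auto simp: split_brace_def)
  have "?q \<in> brace_hom SE.P X"
  proof (rule brace_homI)
    fix u v assume u: "u \<in> carrier SE.P" and v: "v \<in> carrier SE.P"
    obtain a x where xa: "a \<in> carrier A" "x \<in> carrier X" and [simp]: "u = ((f x, a), x)"
      using cases[OF u] by blast
    obtain b z where zb: "b \<in> carrier A" "z \<in> carrier X" and [simp]: "v = ((f z, b), z)"
      using cases[OF v] by blast
    show "?q u \<in> carrier X" using xa by simp
    show "?q (u \<otimes>\<^bsub>SE.P\<^esub> v) = ?q u \<otimes>\<^bsub>X\<^esub> ?q v"
      using xa zb by (simp add: mult_in_fibres split_brace_def)
    show "?q (u \<bullet>\<^bsub>SE.P\<^esub> v) = ?q u \<bullet>\<^bsub>X\<^esub> ?q v"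
      using xa zb by (simp add: cmult_in_fibres split_brace_def)
  qed
  moreover have "f (?q (w, x)) = fst w" if "(w, x) \<in> carrier SE.P" for w x
    using cases[OF that] by auto
  ultimately have "baer_map A (split_seq A Y \<phi>s \<phi>c \<xi>) E E ?q"
    unfolding baer_map_def by (simp add: k_mult del: fibre_product_simps)
  then show ?thesis by (rule SE.baer_map_iso[OF brace_ext_axioms])
qed

section \<open>Negating the kernel map\<close>

lemma neg_seq_simps [simp]:
  "middle (neg_seq A E) = X" "ker_map (neg_seq A E) a = k (inv\<^bsub>A\<^esub> a)" "quo_map (neg_seq A E) = f"
  by (simp_all add: neg_seq_def)

text \<open>The middle term and \<open>f\<close> are kept, so the surjection is the identity. The
  kernel is reparametrised by inversion, with which every component of the direction
  commutes.\<close>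

lemma neg_seq_ext: "neg_seq A E \<in> brace_exts A Y \<phi>s \<phi>c \<xi>"
proof (rule brace_exts_surjI[OF triv X.left_skew_brace_axioms Y.left_skew_brace_axioms
      _ f_hom f_surj, where p = id and \<kappa> = "\<lambda>a. k (inv\<^bsub>A\<^esub> a)"])
  show "(\<lambda>a. k (inv\<^bsub>A\<^esub> a)) \<in> brace_hom (triv_brace A) X"
    by (rule brace_homI) (simp_all add: A.inv_mult k_mult k_cmult[symmetric])
  show "id \<in> brace_hom X (middle (neg_seq A E))" by (rule brace_homI) simp_all
next
  fix u a assume u: "u \<in> carrier X" and a: "a \<in> carrier A"
  show "u \<otimes>\<^bsub>X\<^esub> k (inv\<^bsub>A\<^esub> a) = k (inv\<^bsub>A\<^esub> \<phi>s (f u) a) \<otimes>\<^bsub>X\<^esub> u \<and>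
    u \<bullet>\<^bsub>X\<^esub> k (inv\<^bsub>A\<^esub> a) = k (inv\<^bsub>A\<^esub> \<phi>c (f u) a) \<bullet>\<^bsub>X\<^esub> u \<and>
    k (inv\<^bsub>A\<^esub> a) \<bullet>\<^bsub>X\<^esub> u = k (inv\<^bsub>A\<^esub> \<xi> (f u) a) \<otimes>\<^bsub>X\<^esub> u"
    using u a mult_k[of u "inv\<^bsub>A\<^esub> a"] cmult_k[of u "inv\<^bsub>A\<^esub> a"] k_cmult_eq_mult[of u "inv\<^bsub>A\<^esub> a"]
    by (simp add: phi_s_inv phi_c_inv xi_inv)
next
  fix u assume u: "u \<in> carrier X"
  show "f u = \<one>\<^bsub>Y\<^esub> \<longleftrightarrow> (\<exists>a\<in>carrier A. id u = id (k (inv\<^bsub>A\<^esub> a)))"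
  proof
    assume "f u = \<one>\<^bsub>Y\<^esub>"
    then have "u \<in> k ` carrier A" using u by (simp add: k_image)
    then obtain a where "a \<in> carrier A" "u = k a" by (elim imageE)
    then show "\<exists>a\<in>carrier A. id u = id (k (inv\<^bsub>A\<^esub> a))"
      by (intro bexI[of _ "inv\<^bsub>A\<^esub> a"]) simp_all
  qed auto
qed (auto dest: inj_onD[OF A.inv_inj])

lemma neg_seq_brace_ext: "brace_ext A Y \<phi>s \<phi>c \<xi> (neg_seq A E)"
  by unfold_locales (rule neg_seq_ext)

text \<open>Both sequences have the same middle term and quotient map, so the fibre product is the
  fibre square and \<open>split_map\<close> applies. Relative to the base point with parameter the
  inverse of \<open>a\<close>, the point \<open>k b\<close> has coordinate
  \<open>a \<otimes> b\<close>.\<close>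

lemma neg_seq_inverse: "seq_iso A (baer_sum A (neg_seq A E) E) (split_seq A Y \<phi>s \<phi>c \<xi>)"
proof -
  interpret NE: ext_pair A Y \<phi>s \<phi>c \<xi> "neg_seq A E" E
    by (rule ext_pair.intro[OF neg_seq_brace_ext brace_ext_axioms])
  have P: "NE.P = P2" by (simp add: fibre_product_def)
  have "split_map (k (inv\<^bsub>A\<^esub> a), k b) = (\<one>\<^bsub>Y\<^esub>, a \<otimes>\<^bsub>A\<^esub> b)"
    if "a \<in> carrier A" "b \<in> carrier A" for a b
  proof -
    have "k b = k (a \<otimes>\<^bsub>A\<^esub> b) \<otimes>\<^bsub>X\<^esub> k (inv\<^bsub>A\<^esub> a)"
      using that by (simp add: A.m_comm[of a b] A.m_assoc flip: k_mult)
    then show ?thesis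
      using that split_map_k_mult[of "a \<otimes>\<^bsub>A\<^esub> b" "k (inv\<^bsub>A\<^esub> a)"] by (metis A.inv_closed A.m_closed f_k k_closed)
  qed
  then have "baer_map A (neg_seq A E) E (split_seq A Y \<phi>s \<phi>c \<xi>) split_map"
    unfolding baer_map_def P using split_map_hom by (auto simp: split_map_def)
  then show ?thesis by (rule NE.baer_map_iso[OF split_seq_brace_ext])
qed

section \<open>The group of isomorphism classes\<close>

text \<open>Both laws are carried to the image of \<open>b\<close>, on which \<open>i\<close>
  recovers the original point; \<open>b\<close> itself is then the surjection from which the
  extension property is inherited.\<close>

lemma transport:
  fixes b :: "'x \<Rightarrow> 'v"
  assumes b: "inj_on b (carrier X)"
  obtains G :: "('a, 'v, 'y) brace_seq" where "brace_ext A Y \<phi>s \<phi>c \<xi> G" "seq_iso A E G"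
proof -
  define i where "i = inv_into (carrier X) b"
  have i [simp]: "i (b x) = x" if "x \<in> carrier X" for x
    using b that by (simp add: i_def)
  define G where "G = \<lparr>middle = \<lparr>carrier = b ` carrier X, mult = (\<lambda>u v. b (i u \<otimes>\<^bsub>X\<^esub> i v)),
    one = b \<one>\<^bsub>X\<^esub>, cmult = (\<lambda>u v. b (i u \<bullet>\<^bsub>X\<^esub> i v))\<rparr>, ker_map = b \<circ> k, quo_map = f \<circ> i\<rparr>"
  have G [simp]: "carrier (middle G) = b ` carrier X" "u \<otimes>\<^bsub>middle G\<^esub> v = b (i u \<otimes>\<^bsub>X\<^esub> i v)"
    "u \<bullet>\<^bsub>middle G\<^esub> v = b (i u \<bullet>\<^bsub>X\<^esub> i v)" "\<one>\<^bsub>middle G\<^esub> = b \<one>\<^bsub>X\<^esub>"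
    "ker_map G a = b (k a)" "quo_map G u = f (i u)" for u v a
    by (simp_all add: G_def)
  have hom: "b \<in> brace_hom X (middle G)" by (rule brace_homI) simp_all
  have G_ext: "G \<in> brace_exts A Y \<phi>s \<phi>c \<xi>"
  proof (rule brace_exts_surjI[OF triv X.left_skew_brace_axioms Y.left_skew_brace_axioms
        k_hom f_hom f_surj _ _ hom])
    fix u a assume "u \<in> carrier X" "a \<in> carrier A"
    then show "u \<otimes>\<^bsub>X\<^esub> k a = k (\<phi>s (f u) a) \<otimes>\<^bsub>X\<^esub> u \<and> u \<bullet>\<^bsub>X\<^esub> k a = k (\<phi>c (f u) a) \<bullet>\<^bsub>X\<^esub> u \<and>
        k a \<bullet>\<^bsub>X\<^esub> u = k (\<xi> (f u) a) \<otimes>\<^bsub>X\<^esub> u"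
      using mult_k cmult_k k_cmult_eq_mult by blast
  next
    fix u assume u: "u \<in> carrier X"
    have "f u = \<one>\<^bsub>Y\<^esub> \<longleftrightarrow> u \<in> k ` carrier A" using u by (simp add: k_image)
    also have "\<dots> \<longleftrightarrow> (\<exists>a\<in>carrier A. b u = b (k a))"
      using u inj_onD[OF b] k_closed by (auto simp: image_iff)
    finally show "f u = \<one>\<^bsub>Y\<^esub> \<longleftrightarrow> (\<exists>a\<in>carrier A. b u = b (k a))" .
  next
    fix a c assume "a \<in> carrier A" "c \<in> carrier A" "b (k a) = b (k c)"
    then show "a = c" using inj_onD[OF b, of "k a" "k c"] by simp
  qed simp_all
  interpret G: brace_ext A Y \<phi>s \<phi>c \<xi> G by unfold_locales (rule G_ext)
  interpret EG: ext_pair A Y \<phi>s \<phi>c \<xi> E G ..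
  have "seq_iso A E G" by (rule EG.seq_isoI[OF hom]) simp_all
  then show thesis using that G.brace_ext_axioms by blast
qed

text \<open>A set-theoretic section \<open>s\<close> gives each fibre a base point, and the
  coordinates relative to it embed \<open>X\<close> in \<open>'y \<times> 'a\<close>. Hence
  \<open>seq_class\<close> is never empty, whatever the type of the middle term.\<close>

lemma representative:
  obtains G :: "('a, 'y \<times> 'a, 'y) brace_seq" where "brace_ext A Y \<phi>s \<phi>c \<xi> G" "seq_iso A E G"
proof -
  define s where "s y = (SOME x. x \<in> carrier X \<and> f x = y)" for y
  have s: "s (f x) \<in> carrier X \<and> f (s (f x)) = f x" if "x \<in> carrier X" for x
    unfolding s_def by (rule someI[of _ x]) (use that in simp)
  have "inj_on (\<lambda>x. (f x, coord x (s (f x)))) (carrier X)"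
  proof (rule inj_onI)
    fix x z assume x: "x \<in> carrier X" and z: "z \<in> carrier X"
      and eq: "(f x, coord x (s (f x))) = (f z, coord z (s (f z)))"
    define t where "t = s (f x)"
    have t: "t \<in> carrier X" "f x = f t" "f z = f t" using s[OF x] eq by (simp_all add: t_def)
    obtain a where a: "a \<in> carrier A" "x = k a \<otimes>\<^bsub>X\<^esub> t" using fibre_mult[OF x t(1,2)] .
    obtain c where c: "c \<in> carrier A" "z = k c \<otimes>\<^bsub>X\<^esub> t" using fibre_mult[OF z t(1,3)] .
    have "coord x t = coord z t" using eq by (metis prod.inject t_def)
    then have "a = c" using coord_k_mult[OF a(1) t(1)] coord_k_mult[OF c(1) t(1)] a(2) c(2) by simp
    then show "x = z" using a(2) c(2) by simp
  qed
  then show thesis by (rule transport) (rule that)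
qed

end

section \<open>Classes of sequences with middle terms of arbitrary type\<close>

lemma seq_iso_sym_ext:
  assumes "brace_ext A Y \<phi>s \<phi>c \<xi> E" "brace_ext A Y \<phi>s \<phi>c \<xi> F" "seq_iso A E F"
  shows "seq_iso A F E"
  using ext_pair.seq_iso_sym[OF ext_pair.intro[OF assms(1,2)] assms(3)] .

lemma seq_class_iff:
  assumes "comm_group A"
  shows "G \<in> seq_class A Y \<phi>s \<phi>c \<xi> E \<longleftrightarrow> brace_ext A Y \<phi>s \<phi>c \<xi> G \<and> seq_iso A E G"
  using assms by (simp add: seq_class_def brace_ext_def)

lemma seq_class_eqI:
  assumes E: "brace_ext A Y \<phi>s \<phi>c \<xi> E" and F: "brace_ext A Y \<phi>s \<phi>c \<xi> F" and iso: "seq_iso A E F"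
  shows "seq_class A Y \<phi>s \<phi>c \<xi> E = seq_class A Y \<phi>s \<phi>c \<xi> F"
  using seq_iso_trans[OF iso] seq_iso_trans[OF seq_iso_sym_ext[OF E F iso]]
  by (auto simp: seq_class_def)

text \<open>Classes are nonempty, so equal classes share a representative, and \<open>E\<close> and
  \<open>F\<close> are isomorphic through it even when their middle terms have different
  types.\<close>

lemma seq_class_eq_iff:
  fixes A :: "'a monoid" and Y :: "'y skew_brace"
  assumes E: "brace_ext A Y \<phi>s \<phi>c \<xi> E" and F: "brace_ext A Y \<phi>s \<phi>c \<xi> F"
  shows "seq_class A Y \<phi>s \<phi>c \<xi> E = seq_class A Y \<phi>s \<phi>c \<xi> F \<longleftrightarrow> seq_iso A E F"
proof
  assume eq: "seq_class A Y \<phi>s \<phi>c \<xi> E = seq_class A Y \<phi>s \<phi>c \<xi> F"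
  obtain G :: "('a, 'y \<times> 'a, 'y) brace_seq" where G: "brace_ext A Y \<phi>s \<phi>c \<xi> G" "seq_iso A E G"
    using E by (rule brace_ext.representative)
  note A = brace_ext.A[OF E]
  have "G \<in> seq_class A Y \<phi>s \<phi>c \<xi> F" using G unfolding eq[symmetric] seq_class_iff[OF A] by simp
  then have "seq_iso A F G" unfolding seq_class_iff[OF A] by simp
  with G(2) show "seq_iso A E F" using seq_iso_trans seq_iso_sym_ext[OF F G(1)] by blast
qed (rule seq_class_eqI[OF E F])

lemma rel_image_eq_seq_class:
  assumes "brace_ext A Y \<phi>s \<phi>c \<xi> E"
  shows "seq_iso_rel A Y \<phi>s \<phi>c \<xi> `` {E} = seq_class A Y \<phi>s \<phi>c \<xi> E"
  using brace_ext.ext[OF assms] by (auto simp: seq_iso_rel_def seq_class_def)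

lemma ext_group_cases:
  fixes A :: "'a monoid" and Y :: "'y skew_brace"
  assumes "comm_group A" and "C \<in> carrier (ext_group A Y \<phi>s \<phi>c \<xi>)"
  obtains E :: "('a, 'y \<times> 'a, 'y) brace_seq"
  where "brace_ext A Y \<phi>s \<phi>c \<xi> E" "C = seq_class A Y \<phi>s \<phi>c \<xi> E"
proof -
  obtain E where E: "E \<in> brace_exts A Y \<phi>s \<phi>c \<xi>" "C = seq_iso_rel A Y \<phi>s \<phi>c \<xi> `` {E}"
    using assms(2) by (auto simp: ext_group_def elim: quotientE)
  then have "brace_ext A Y \<phi>s \<phi>c \<xi> E" using assms(1) by (simp add: brace_ext_def)
  then show thesis using that E(2) rel_image_eq_seq_class by blast
qed

text \<open>\<open>E\<close> may live on any type; a representative on the fixed type has the same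
  class, which is an element of the quotient.\<close>

lemma seq_class_closed:
  fixes A :: "'a monoid" and Y :: "'y skew_brace"
  assumes E: "brace_ext A Y \<phi>s \<phi>c \<xi> E"
  shows "seq_class A Y \<phi>s \<phi>c \<xi> E \<in> carrier (ext_group A Y \<phi>s \<phi>c \<xi>)"
proof -
  obtain G :: "('a, 'y \<times> 'a, 'y) brace_seq" where G: "brace_ext A Y \<phi>s \<phi>c \<xi> G" "seq_iso A E G"
    using E by (rule brace_ext.representative)
  have "seq_class A Y \<phi>s \<phi>c \<xi> E = seq_iso_rel A Y \<phi>s \<phi>c \<xi> `` {G}"
    using seq_class_eqI[OF E G] rel_image_eq_seq_class[OF G(1)] by simp
  then show ?thesis using quotientI[OF brace_ext.ext[OF G(1)]] by (simp add: ext_group_def)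
qed

text \<open>By \<open>baer_sum_cong\<close> all terms of the double union are the same class.
  Nonemptiness of both factors keeps the union from being empty.\<close>

lemma seq_class_mult:
  fixes A :: "'a monoid" and Y :: "'y skew_brace"
  assumes E: "brace_ext A Y \<phi>s \<phi>c \<xi> E" and F: "brace_ext A Y \<phi>s \<phi>c \<xi> F"
  shows "seq_class A Y \<phi>s \<phi>c \<xi> E \<otimes>\<^bsub>ext_group A Y \<phi>s \<phi>c \<xi>\<^esub> seq_class A Y \<phi>s \<phi>c \<xi> F
    = seq_class A Y \<phi>s \<phi>c \<xi> (baer_sum A E F)"
proof -
  note A = brace_ext.A[OF E]
  have eq: "seq_class A Y \<phi>s \<phi>c \<xi> (baer_sum A E' F') = seq_class A Y \<phi>s \<phi>c \<xi> (baer_sum A E F)"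
    if "E' \<in> seq_class A Y \<phi>s \<phi>c \<xi> E" "F' \<in> seq_class A Y \<phi>s \<phi>c \<xi> F" for E' F'
  proof -
    have EF': "brace_ext A Y \<phi>s \<phi>c \<xi> E'" "seq_iso A E E'" "brace_ext A Y \<phi>s \<phi>c \<xi> F'" "seq_iso A F F'"
      using that by (simp_all add: seq_class_iff[OF A])
    interpret S: ext_pair A Y \<phi>s \<phi>c \<xi> E F by (rule ext_pair.intro[OF E F])
    interpret S': ext_pair A Y \<phi>s \<phi>c \<xi> E' F' by (rule ext_pair.intro[OF EF'(1,3)])
    have "seq_iso A (baer_sum A E F) (baer_sum A E' F')"
      by (rule baer_sum_cong[OF S.ext_pair_axioms S'.ext_pair_axioms EF'(2,4)])
    then show ?thesis using seq_class_eqI[OF S.S.brace_ext_axioms S'.S.brace_ext_axioms] by metis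
  qed
  obtain G :: "('a, 'y \<times> 'a, 'y) brace_seq" where "brace_ext A Y \<phi>s \<phi>c \<xi> G" "seq_iso A E G"
    using E by (rule brace_ext.representative)
  then have "seq_class A Y \<phi>s \<phi>c \<xi> E \<noteq> {}" using seq_class_iff[OF A] by blast
  moreover obtain H :: "('a, 'y \<times> 'a, 'y) brace_seq" where "brace_ext A Y \<phi>s \<phi>c \<xi> H" "seq_iso A F H"
    using F by (rule brace_ext.representative)
  then have "seq_class A Y \<phi>s \<phi>c \<xi> F \<noteq> {}" using seq_class_iff[OF A] by blast
  ultimately have "(\<Union>E'\<in>seq_class A Y \<phi>s \<phi>c \<xi> E. \<Union>F'\<in>seq_class A Y \<phi>s \<phi>c \<xi> F.
      seq_class A Y \<phi>s \<phi>c \<xi> (baer_sum A E' F')) = seq_class A Y \<phi>s \<phi>c \<xi> (baer_sum A E F)"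
    by (simp add: eq)
  then show ?thesis by (simp add: ext_group_def)
qed

text \<open>\<open>E0\<close> realises the direction, which is what makes the split sequence
  available as unit. The laws are isomorphisms of Baer sums translated by
  \<open>seq_class_mult\<close>, which for associativity is applied to factors that are themselves
  Baer sums.\<close>

lemma comm_group_ext_group:
  fixes A :: "'a monoid" and Y :: "'y skew_brace" and E0 :: "('a, 'w, 'y) brace_seq"
  assumes "brace_ext A Y \<phi>s \<phi>c \<xi> E0"
  shows "comm_group (ext_group A Y \<phi>s \<phi>c \<xi>)"
proof -
  let ?split = "split_seq A Y \<phi>s \<phi>c \<xi>"
  let ?ext = "brace_ext A Y \<phi>s \<phi>c \<xi> :: ('a, 'y \<times> 'a, 'y) brace_seq \<Rightarrow> bool"
  note A = brace_ext.A[OF assms] and split = brace_ext.split_seq_brace_ext[OF assms]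
  note cases = ext_group_cases[OF A, of _ Y \<phi>s \<phi>c \<xi>]
  have one: "\<one>\<^bsub>ext_group A Y \<phi>s \<phi>c \<xi>\<^esub> = seq_class A Y \<phi>s \<phi>c \<xi> ?split"
    by (simp add: ext_group_def)
  have sum: "brace_ext A Y \<phi>s \<phi>c \<xi> (baer_sum A E F)" if "?ext E" "?ext F" for E F
  proof -
    interpret ext_pair A Y \<phi>s \<phi>c \<xi> E F by (rule ext_pair.intro[OF that])
    show ?thesis by (rule S.brace_ext_axioms)
  qed
  show ?thesis
  proof (rule comm_groupI)
    fix C D assume "C \<in> carrier (ext_group A Y \<phi>s \<phi>c \<xi>)" "D \<in> carrier (ext_group A Y \<phi>s \<phi>c \<xi>)"
    then obtain E F where E: "?ext E" "C = seq_class A Y \<phi>s \<phi>c \<xi> E"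
      and F: "?ext F" "D = seq_class A Y \<phi>s \<phi>c \<xi> F" by (metis cases)
    show "C \<otimes>\<^bsub>ext_group A Y \<phi>s \<phi>c \<xi>\<^esub> D \<in> carrier (ext_group A Y \<phi>s \<phi>c \<xi>)"
      unfolding E(2) F(2) seq_class_mult[OF E(1) F(1)] by (rule seq_class_closed[OF sum[OF E(1) F(1)]])
    show "C \<otimes>\<^bsub>ext_group A Y \<phi>s \<phi>c \<xi>\<^esub> D = D \<otimes>\<^bsub>ext_group A Y \<phi>s \<phi>c \<xi>\<^esub> C"
      unfolding E(2) F(2) seq_class_mult[OF E(1) F(1)] seq_class_mult[OF F(1) E(1)]
      by (rule seq_class_eqI[OF sum[OF E(1) F(1)] sum[OF F(1) E(1)]
            baer_sum_comm[OF ext_pair.intro[OF E(1) F(1)]]])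
    fix C' assume "C' \<in> carrier (ext_group A Y \<phi>s \<phi>c \<xi>)"
    then obtain G where G: "?ext G" "C' = seq_class A Y \<phi>s \<phi>c \<xi> G" by (metis cases)
    interpret EF: ext_pair A Y \<phi>s \<phi>c \<xi> E F by (rule ext_pair.intro[OF E(1) F(1)])
    interpret FG: ext_pair A Y \<phi>s \<phi>c \<xi> F G by (rule ext_pair.intro[OF F(1) G(1)])
    interpret L: ext_pair A Y \<phi>s \<phi>c \<xi> "baer_sum A E F" G ..
    interpret R: ext_pair A Y \<phi>s \<phi>c \<xi> E "baer_sum A F G" ..
    show "C \<otimes>\<^bsub>ext_group A Y \<phi>s \<phi>c \<xi>\<^esub> D \<otimes>\<^bsub>ext_group A Y \<phi>s \<phi>c \<xi>\<^esub> C'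
        = C \<otimes>\<^bsub>ext_group A Y \<phi>s \<phi>c \<xi>\<^esub> (D \<otimes>\<^bsub>ext_group A Y \<phi>s \<phi>c \<xi>\<^esub> C')"
      unfolding E(2) F(2) G(2) seq_class_mult[OF E(1) F(1)] seq_class_mult[OF F(1) G(1)]
        seq_class_mult[OF EF.S.brace_ext_axioms G(1)] seq_class_mult[OF E(1) FG.S.brace_ext_axioms]
      by (rule seq_class_eqI[OF L.S.brace_ext_axioms R.S.brace_ext_axioms
            baer_sum_assoc[OF E(1) F(1) G(1)]])
  next
    show "\<one>\<^bsub>ext_group A Y \<phi>s \<phi>c \<xi>\<^esub> \<in> carrier (ext_group A Y \<phi>s \<phi>c \<xi>)"
      unfolding one by (rule seq_class_closed[OF split])
  next
    fix C assume "C \<in> carrier (ext_group A Y \<phi>s \<phi>c \<xi>)"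
    then obtain E where E: "?ext E" "C = seq_class A Y \<phi>s \<phi>c \<xi> E" by (rule cases)
    show "\<one>\<^bsub>ext_group A Y \<phi>s \<phi>c \<xi>\<^esub> \<otimes>\<^bsub>ext_group A Y \<phi>s \<phi>c \<xi>\<^esub> C = C"
      unfolding E(2) one seq_class_mult[OF split E(1)]
      by (rule seq_class_eqI[OF sum[OF split E(1)] E(1) brace_ext.split_seq_unit[OF E(1)]])
    note neg = brace_ext.neg_seq_brace_ext[OF E(1)]
    have "seq_class A Y \<phi>s \<phi>c \<xi> (neg_seq A E) \<otimes>\<^bsub>ext_group A Y \<phi>s \<phi>c \<xi>\<^esub> C
        = \<one>\<^bsub>ext_group A Y \<phi>s \<phi>c \<xi>\<^esub>"
      unfolding E(2) one seq_class_mult[OF neg E(1)]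
      by (rule seq_class_eqI[OF sum[OF neg E(1)] split brace_ext.neg_seq_inverse[OF E(1)]])
    then show "\<exists>D\<in>carrier (ext_group A Y \<phi>s \<phi>c \<xi>).
        D \<otimes>\<^bsub>ext_group A Y \<phi>s \<phi>c \<xi>\<^esub> C = \<one>\<^bsub>ext_group A Y \<phi>s \<phi>c \<xi>\<^esub>"
      using seq_class_closed[OF neg] by blast
  qed
qed

lemma seq_class_inv:
  assumes E: "brace_ext A Y \<phi>s \<phi>c \<xi> E"
  shows "inv\<^bsub>ext_group A Y \<phi>s \<phi>c \<xi>\<^esub> seq_class A Y \<phi>s \<phi>c \<xi> E = seq_class A Y \<phi>s \<phi>c \<xi> (neg_seq A E)"
proof -
  note neg = brace_ext.neg_seq_brace_ext[OF E] and split = brace_ext.split_seq_brace_ext[OF E]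
  interpret G: comm_group "ext_group A Y \<phi>s \<phi>c \<xi>" using E by (rule comm_group_ext_group)
  interpret S: ext_pair A Y \<phi>s \<phi>c \<xi> "neg_seq A E" E by (rule ext_pair.intro[OF neg E])
  have "seq_class A Y \<phi>s \<phi>c \<xi> (neg_seq A E) \<otimes>\<^bsub>ext_group A Y \<phi>s \<phi>c \<xi>\<^esub> seq_class A Y \<phi>s \<phi>c \<xi> E
      = seq_class A Y \<phi>s \<phi>c \<xi> (split_seq A Y \<phi>s \<phi>c \<xi>)"
    unfolding seq_class_mult[OF neg E]
    by (rule seq_class_eqI[OF S.S.brace_ext_axioms split brace_ext.neg_seq_inverse[OF E]])
  also have "\<dots> = \<one>\<^bsub>ext_group A Y \<phi>s \<phi>c \<xi>\<^esub>" by (simp add: ext_group_def)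
  finally show ?thesis
    by (rule G.inv_equality[OF _ seq_class_closed[OF E] seq_class_closed[OF neg]])
qed

text \<open>The types \<open>'x1\<close> and \<open>'x2\<close> are arbitrary because a group built
  on one fixed type would by itself speak only of sequences on that type; the clauses on
  \<open>seq_class\<close> extend its meaning to all middle terms.\<close>

theorem mainTheorem2:
  fixes A :: "'a monoid" and Y :: "'y skew_brace"
    and \<phi>s \<phi>c \<xi> :: "'y \<Rightarrow> 'a \<Rightarrow> 'a"
    and E0 :: "('a, 'w, 'y) brace_seq"
  assumes "left_skew_brace Y" and "comm_group A"
    and "exact_brace_seq A Y E0" and "has_direction A Y E0 \<phi>s \<phi>c \<xi>"
  shows
    "(\<forall>(E :: ('a, 'x1, 'y) brace_seq) (F :: ('a, 'x2, 'y) brace_seq).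
        E \<in> brace_exts A Y \<phi>s \<phi>c \<xi> \<and> F \<in> brace_exts A Y \<phi>s \<phi>c \<xi> \<longrightarrow>
          brace_ideal (antidiagonal A E F) (fibre_product E F) \<and>
          baer_quotient_map A E F \<in> brace_hom (fibre_product E F) (middle (baer_sum A E F)) \<and>
          (\<forall>(x, x') \<in> carrier (fibre_product E F).
             quo_map (baer_sum A E F) (baer_quotient_map A E F (x, x')) = quo_map E x) \<and>
          exact_brace_seq A Y (baer_sum A E F) \<and>
          has_direction A Y (baer_sum A E F) \<phi>s \<phi>c \<xi>)
     \<and> comm_group (ext_group A Y \<phi>s \<phi>c \<xi>)
     \<and> (\<forall>E :: ('a, 'x1, 'y) brace_seq. E \<in> brace_exts A Y \<phi>s \<phi>c \<xi> \<longrightarrow>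
          seq_class A Y \<phi>s \<phi>c \<xi> E \<in> carrier (ext_group A Y \<phi>s \<phi>c \<xi>))
     \<and> (\<forall>(E :: ('a, 'x1, 'y) brace_seq) (F :: ('a, 'x2, 'y) brace_seq).
        E \<in> brace_exts A Y \<phi>s \<phi>c \<xi> \<and> F \<in> brace_exts A Y \<phi>s \<phi>c \<xi> \<longrightarrow>
          (seq_class A Y \<phi>s \<phi>c \<xi> E = seq_class A Y \<phi>s \<phi>c \<xi> F \<longleftrightarrow> seq_iso A E F) \<and>
          seq_class A Y \<phi>s \<phi>c \<xi> E \<otimes>\<^bsub>ext_group A Y \<phi>s \<phi>c \<xi>\<^esub> seq_class A Y \<phi>s \<phi>c \<xi> F
            = seq_class A Y \<phi>s \<phi>c \<xi> (baer_sum A E F))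
     \<and> (\<forall>E :: ('a, 'x1, 'y) brace_seq. E \<in> brace_exts A Y \<phi>s \<phi>c \<xi> \<longrightarrow>
          neg_seq A E \<in> brace_exts A Y \<phi>s \<phi>c \<xi> \<and>
          inv\<^bsub>ext_group A Y \<phi>s \<phi>c \<xi>\<^esub> (seq_class A Y \<phi>s \<phi>c \<xi> E)
            = seq_class A Y \<phi>s \<phi>c \<xi> (neg_seq A E))
     \<and> left_skew_brace (split_brace A Y \<phi>s \<phi>c \<xi>)
     \<and> split_seq A Y \<phi>s \<phi>c \<xi> \<in> brace_exts A Y \<phi>s \<phi>c \<xi>
     \<and> \<one>\<^bsub>ext_group A Y \<phi>s \<phi>c \<xi>\<^esub> = seq_class A Y \<phi>s \<phi>c \<xi> (split_seq A Y \<phi>s \<phi>c \<xi>)"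
proof -
  have E0: "brace_ext A Y \<phi>s \<phi>c \<xi> E0" using assms by (simp add: brace_ext_def brace_exts_def)
  have ext: "brace_ext A Y \<phi>s \<phi>c \<xi> E \<longleftrightarrow> E \<in> brace_exts A Y \<phi>s \<phi>c \<xi>"
    for E :: "('a, 'x1, 'y) brace_seq"
    using assms(2) by (simp add: brace_ext_def)
  have ext': "brace_ext A Y \<phi>s \<phi>c \<xi> F \<longleftrightarrow> F \<in> brace_exts A Y \<phi>s \<phi>c \<xi>"
    for F :: "('a, 'x2, 'y) brace_seq"
    using assms(2) by (simp add: brace_ext_def)
  note split = brace_ext.split_seq_brace_ext[OF E0]
  show ?thesis
  proof (intro conjI allI impI; (elim conjE)?)
    fix E :: "('a, 'x1, 'y) brace_seq" and F :: "('a, 'x2, 'y) brace_seq"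
    assume "E \<in> brace_exts A Y \<phi>s \<phi>c \<xi>" "F \<in> brace_exts A Y \<phi>s \<phi>c \<xi>"
    then have EF: "brace_ext A Y \<phi>s \<phi>c \<xi> E" "brace_ext A Y \<phi>s \<phi>c \<xi> F" by (simp_all add: ext ext')
    interpret ext_pair A Y \<phi>s \<phi>c \<xi> E F by (rule ext_pair.intro[OF EF])
    show "brace_ideal N P" by (rule antidiagonal_ideal)
    show "\<theta> \<in> brace_hom P (middle (baer_sum A E F))" by (rule theta_hom)
    show "\<forall>(x, x')\<in>carrier P. quo_map (baer_sum A E F) (\<theta> (x, x')) = quo_map E x"
      using quo_map_theta by blast
    show "exact_brace_seq A Y (baer_sum A E F)" "has_direction A Y (baer_sum A E F) \<phi>s \<phi>c \<xi>"
      using baer_sum_ext by (simp_all add: brace_exts_def)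
    show "seq_class A Y \<phi>s \<phi>c \<xi> E = seq_class A Y \<phi>s \<phi>c \<xi> F \<longleftrightarrow> seq_iso A E F"
      by (rule seq_class_eq_iff[OF EF])
    show "seq_class A Y \<phi>s \<phi>c \<xi> E \<otimes>\<^bsub>ext_group A Y \<phi>s \<phi>c \<xi>\<^esub> seq_class A Y \<phi>s \<phi>c \<xi> F
        = seq_class A Y \<phi>s \<phi>c \<xi> (baer_sum A E F)"
      by (rule seq_class_mult[OF EF])
  next
    fix E :: "('a, 'x1, 'y) brace_seq"
    assume "E \<in> brace_exts A Y \<phi>s \<phi>c \<xi>"
    then have E: "brace_ext A Y \<phi>s \<phi>c \<xi> E" by (simp add: ext)
    show "seq_class A Y \<phi>s \<phi>c \<xi> E \<in> carrier (ext_group A Y \<phi>s \<phi>c \<xi>)"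
      by (rule seq_class_closed[OF E])
    show "neg_seq A E \<in> brace_exts A Y \<phi>s \<phi>c \<xi>" by (rule brace_ext.neg_seq_ext[OF E])
    show "inv\<^bsub>ext_group A Y \<phi>s \<phi>c \<xi>\<^esub> (seq_class A Y \<phi>s \<phi>c \<xi> E)
        = seq_class A Y \<phi>s \<phi>c \<xi> (neg_seq A E)"
      by (rule seq_class_inv[OF E])
  next
    show "comm_group (ext_group A Y \<phi>s \<phi>c \<xi>)" by (rule comm_group_ext_group[OF E0])
    show "split_seq A Y \<phi>s \<phi>c \<xi> \<in> brace_exts A Y \<phi>s \<phi>c \<xi>" by (rule brace_ext.split_seq_ext[OF E0])
    then show "left_skew_brace (split_brace A Y \<phi>s \<phi>c \<xi>)"
      by (simp add: brace_exts_def exact_brace_seq_def split_seq_def)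
    show "\<one>\<^bsub>ext_group A Y \<phi>s \<phi>c \<xi>\<^esub> = seq_class A Y \<phi>s \<phi>c \<xi> (split_seq A Y \<phi>s \<phi>c \<xi>)"
      by (simp add: ext_group_def)
  qed
qed

end
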